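(* Let $n,m\ge 1$ be integers and suppose that $G=\mathrm{Art}_{2,2n+1,2m+1}=\langle a,b,c\mid ac=ca,\ (bc)^nb=c(bc)^n,\ (ab)^ma=b(ab)^m\rangle$ acts by isometries on a simplicial tree $T$ minimally (i.e. there are no proper $G$-invariant subtrees). Then one of the following holds. 1) If $\mathrm{Fix}(a)\ne\emptyset$, the tree $T$ is a point. 2) If $\mathrm{Fix}(a)=\emptyset$ and $\mathrm{Fix}(ab)=\emptyset$ (or $\mathrm{Fix}(a)=\emptyset$ and $\mathrm{Fix}(cb)=\emptyset$), the tree $T$ is isometric to $\mathbb{R}$, on which $G$ acts by translations. 3) If $\mathrm{Fix}(a)=\emptyset$, $\mathrm{Fix}(ab)\ne\emptyset$ and $\mathrm{Fix}(cb)\neq\emptyset$, the tree $T$ has a geodesic path $e=[p_0,q_0]$ with vertex stabilizers $$G_{q_0}\supset\langle cb,ab\rangle,\qquad G_{p_0}\supset\langle (cb)^nc,(ab)^ma\rangle,$$ and the path stabilizer $$G_e\supset\langle (ab)(cb)^{-1},\ (cb)^{-n}(ab)^m,\ (cb)^n(ab)^{-m},\ (cb)^{2n+1},\ (ab)^{2m+1}\rangle.$$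
   Context: For an isometry $g$ of $T$, $\mathrm{Fix}(g)=\{x\in T: gx=x\}$. $G_{p_0}$ and $G_{q_0}$ denote the stabilizers in $G$ of the end vertices $p_0$ and $q_0$ of the path $e$, and $G_e$ is the stabilizer of the path $e$ (the elements fixing both $p_0$ and $q_0$).
   Formalization: In case 3 the endpoints p_0, q_0 are vertices of T if no element inverts an edge; otherwise they may be midpoints of edges (B_4 on the trivalent tree has no vertex p_0). Invariant subtrees are read as connected subsets of T, not only subcomplexes (a flipped edge would violate case 1). *)

theory Defs
  imports "HOL-Analysis.Analysis" "HOL-Algebra.Group_Action" "HOL-Algebra.Generated_Groups"
begin

section \<open>Groups given by a presentation\<close>

text \<open>A word is a list of letters; the letter \<open>(x, True)\<close> stands for the generator \<open>x\<close> and
  \<open>(x, False)\<close> for its formal inverse.\<close>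

type_synonym 'g word = "('g \<times> bool) list"

inductive pres_eq :: "('g word \<times> 'g word) set \<Rightarrow> 'g word \<Rightarrow> 'g word \<Rightarrow> bool"
  for R :: "('g word \<times> 'g word) set" where
  rel: "(u, v) \<in> R \<Longrightarrow> pres_eq R u v"
| cancel: "pres_eq R [(x, s), (x, \<not> s)] []"
| refl: "pres_eq R u u"
| sym: "pres_eq R u v \<Longrightarrow> pres_eq R v u"
| trans: "pres_eq R u v \<Longrightarrow> pres_eq R v w \<Longrightarrow> pres_eq R u w"
| append: "pres_eq R u u' \<Longrightarrow> pres_eq R v v' \<Longrightarrow> pres_eq R (u @ v) (u' @ v')"

definition pres_rel :: "('g word \<times> 'g word) set \<Rightarrow> ('g word \<times> 'g word) set" where
  "pres_rel R = {(u, v). pres_eq R u v}"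

definition pres_class :: "('g word \<times> 'g word) set \<Rightarrow> 'g word \<Rightarrow> 'g word set" where
  "pres_class R u = pres_rel R `` {u}"

definition presented_group :: "('g word \<times> 'g word) set \<Rightarrow> 'g word set monoid" where
  "presented_group R =
    \<lparr>carrier = UNIV // pres_rel R,
     mult = (\<lambda>X Y. \<Union>u\<in>X. \<Union>v\<in>Y. pres_class R (u @ v)),
     one = pres_class R []\<rparr>"

definition pres_gen :: "('g word \<times> 'g word) set \<Rightarrow> 'g \<Rightarrow> 'g word set" where
  "pres_gen R x = pres_class R [(x, True)]"

lemma equiv_pres_rel: "equiv UNIV (pres_rel R)"
proof (rule equivI)
  show "pres_rel R \<subseteq> UNIV \<times> UNIV" by simp
  show "refl_on UNIV (pres_rel R)"
    by (simp add: refl_on_def pres_rel_def pres_eq.refl)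
  show "sym (pres_rel R)"
    unfolding sym_def pres_rel_def by (simp add: pres_eq.sym)
  show "trans (pres_rel R)"
    unfolding trans_def pres_rel_def by simp (metis pres_eq.trans)
qed

lemma pres_class_eq_iff: "pres_class R u = pres_class R v \<longleftrightarrow> pres_eq R u v"
  unfolding pres_class_def
  using eq_equiv_class_iff[OF equiv_pres_rel, of u v R] by (simp add: pres_rel_def)

lemma carrier_presented_group: "carrier (presented_group R) = range (pres_class R)"
  by (auto simp: presented_group_def pres_class_def quotient_def)

lemma one_presented_group: "\<one>\<^bsub>presented_group R\<^esub> = pres_class R []"
  by (simp add: presented_group_def)

lemma mult_presented_group:
  "pres_class R u \<otimes>\<^bsub>presented_group R\<^esub> pres_class R v = pres_class R (u @ v)"
proof -
  have eq: "pres_class R (u' @ v') = pres_class R (u @ v)"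
    if "u' \<in> pres_class R u" "v' \<in> pres_class R v" for u' v'
    using that unfolding pres_class_eq_iff
    by (simp add: pres_class_def pres_rel_def pres_eq.append pres_eq.sym)
  have u: "u \<in> pres_class R u" and v: "v \<in> pres_class R v"
    by (simp_all add: pres_class_def pres_rel_def pres_eq.refl)
  have "(\<Union>u'\<in>pres_class R u. \<Union>v'\<in>pres_class R v. pres_class R (u' @ v'))
      = pres_class R (u @ v)"
    by (intro UN_constant_eq[OF u] UN_constant_eq[OF v] ballI eq)
  then show ?thesis
    by (simp add: presented_group_def)
qed

lemma pres_eq_inverse: "pres_eq R (rev (map (\<lambda>(x, s). (x, \<not> s)) u) @ u) []"
proof (induction u)
  case Nil
  then show ?case by (simp add: pres_eq.refl)
next
  case (Cons y u)
  obtain x s where y: "y = (x, s)" by fastforce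
  let ?r = "rev (map (\<lambda>(x, s). (x, \<not> s)) u)"
  have "pres_eq R ([(x, \<not> s), (x, s)] @ u) ([] @ u)"
    using pres_eq.append[of R "[(x, \<not> s), (x, s)]" "[]" u u] pres_eq.cancel[of R x "\<not> s"]
    by (simp add: pres_eq.refl)
  then have "pres_eq R (?r @ ([(x, \<not> s), (x, s)] @ u)) (?r @ ([] @ u))"
    by (rule pres_eq.append[OF pres_eq.refl])
  then show ?case
    using pres_eq.trans[OF _ Cons.IH] y by simp
qed

lemma group_presented_group: "group (presented_group R)"
proof (rule groupI)
  fix X assume "X \<in> carrier (presented_group R)"
  then obtain u where u: "X = pres_class R u" by (auto simp: carrier_presented_group)
  show "\<exists>Y\<in>carrier (presented_group R). Y \<otimes>\<^bsub>presented_group R\<^esub> X = \<one>\<^bsub>presented_group R\<^esub>"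
  proof (rule bexI)
    show "pres_class R (rev (map (\<lambda>(x, s). (x, \<not> s)) u)) \<otimes>\<^bsub>presented_group R\<^esub> X
        = \<one>\<^bsub>presented_group R\<^esub>"
      unfolding u mult_presented_group one_presented_group pres_class_eq_iff
      by (rule pres_eq_inverse)
  qed (simp add: carrier_presented_group)
next
  fix X Y assume "X \<in> carrier (presented_group R)" "Y \<in> carrier (presented_group R)"
  then obtain u v where "X = pres_class R u" "Y = pres_class R v"
    by (auto simp: carrier_presented_group)
  then show "X \<otimes>\<^bsub>presented_group R\<^esub> Y \<in> carrier (presented_group R)"
    by (simp add: carrier_presented_group mult_presented_group)
next
  fix X Y Z
  assume "X \<in> carrier (presented_group R)" "Y \<in> carrier (presented_group R)"
    "Z \<in> carrier (presented_group R)"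
  then obtain u v w where "X = pres_class R u" "Y = pres_class R v" "Z = pres_class R w"
    by (auto simp: carrier_presented_group)
  then show "X \<otimes>\<^bsub>presented_group R\<^esub> Y \<otimes>\<^bsub>presented_group R\<^esub> Z
      = X \<otimes>\<^bsub>presented_group R\<^esub> (Y \<otimes>\<^bsub>presented_group R\<^esub> Z)"
    by (simp add: mult_presented_group)
next
  show "\<one>\<^bsub>presented_group R\<^esub> \<in> carrier (presented_group R)"
    by (simp add: carrier_presented_group one_presented_group)
next
  fix X assume "X \<in> carrier (presented_group R)"
  then obtain u where "X = pres_class R u" by (auto simp: carrier_presented_group)
  then show "\<one>\<^bsub>presented_group R\<^esub> \<otimes>\<^bsub>presented_group R\<^esub> X = X"
    by (simp add: one_presented_group mult_presented_group)
qed

lemma pres_gen_closed: "pres_gen R x \<in> carrier (presented_group R)"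
  by (simp add: pres_gen_def carrier_presented_group)


section \<open>The Artin group \<open>Art\<^sub>2\<^sub>,\<^sub>2\<^sub>n\<^sub>+\<^sub>1\<^sub>,\<^sub>2\<^sub>m\<^sub>+\<^sub>1\<close>\<close>

datatype artin_gen = GenA | GenB | GenC

fun word_pow :: "'g word \<Rightarrow> nat \<Rightarrow> 'g word" where
  "word_pow u 0 = []"
| "word_pow u (Suc k) = u @ word_pow u k"

definition artin_relations :: "nat \<Rightarrow> nat \<Rightarrow> (artin_gen word \<times> artin_gen word) set" where
  "artin_relations n m =
    (let a = [(GenA, True)]; b = [(GenB, True)]; c = [(GenC, True)] in
      {(a @ c, c @ a),
       (word_pow (b @ c) n @ b, c @ word_pow (b @ c) n),
       (word_pow (a @ b) m @ a, b @ word_pow (a @ b) m)})"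

definition Artin_2_odd_odd :: "nat \<Rightarrow> nat \<Rightarrow> artin_gen word set monoid" where
  "Artin_2_odd_odd n m = presented_group (artin_relations n m)"

definition artin_elt :: "nat \<Rightarrow> nat \<Rightarrow> artin_gen \<Rightarrow> artin_gen word set" where
  "artin_elt n m x = pres_gen (artin_relations n m) x"

lemma group_Artin_2_odd_odd: "group (Artin_2_odd_odd n m)"
  by (simp add: Artin_2_odd_odd_def group_presented_group)

lemma artin_elt_closed: "artin_elt n m x \<in> carrier (Artin_2_odd_odd n m)"
  by (simp add: artin_elt_def Artin_2_odd_odd_def pres_gen_closed)

lemma pres_class_word_pow:
  "pres_class R (word_pow u k) = pres_class R u [^]\<^bsub>presented_group R\<^esub> k"
proof (induction k)
  case 0
  then show ?case by (simp add: one_presented_group)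
next
  case (Suc k)
  interpret group "presented_group R" by (rule group_presented_group)
  have "pres_class R (word_pow u (Suc k))
      = pres_class R u \<otimes>\<^bsub>presented_group R\<^esub> pres_class R (word_pow u k)"
    unfolding mult_presented_group by (simp only: word_pow.simps)
  also have "\<dots> = pres_class R u [^]\<^bsub>presented_group R\<^esub> Suc k"
    unfolding Suc.IH by (rule nat_pow_Suc2[symmetric]) (simp add: carrier_presented_group)
  finally show ?case .
qed

lemma Artin_2_odd_odd_relations:
  fixes G (structure)
  assumes "G = Artin_2_odd_odd n m"
    and "a = artin_elt n m GenA" and "b = artin_elt n m GenB" and "c = artin_elt n m GenC"
  shows "a \<otimes> c = c \<otimes> a"
    and "(b \<otimes> c) [^] n \<otimes> b = c \<otimes> (b \<otimes> c) [^] n"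
    and "(a \<otimes> b) [^] m \<otimes> a = b \<otimes> (a \<otimes> b) [^] m"
proof -
  let ?R = "artin_relations n m"
  let ?c = "pres_class ?R"
  have G: "G = presented_group ?R"
    and gens: "a = ?c [(GenA, True)]" "b = ?c [(GenB, True)]" "c = ?c [(GenC, True)]"
    by (simp_all only: assms Artin_2_odd_odd_def artin_elt_def pres_gen_def)
  have eq: "?c u = ?c v" if "(u, v) \<in> ?R" for u v
    using pres_eq.rel[OF that] by (simp only: pres_class_eq_iff)
  show "a \<otimes> c = c \<otimes> a"
    unfolding G gens mult_presented_group
    by (rule eq) (simp only: artin_relations_def Let_def insert_iff simp_thms)
  show "(b \<otimes> c) [^] n \<otimes> b = c \<otimes> (b \<otimes> c) [^] n"
    unfolding G gens mult_presented_group pres_class_word_pow[symmetric]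
    by (rule eq) (simp only: artin_relations_def Let_def insert_iff simp_thms)
  show "(a \<otimes> b) [^] m \<otimes> a = b \<otimes> (a \<otimes> b) [^] m"
    unfolding G gens mult_presented_group pres_class_word_pow[symmetric]
    by (rule eq) (simp only: artin_relations_def Let_def insert_iff simp_thms)
qed


section \<open>Simplicial trees as metric spaces\<close>

definition geodesic_segment :: "'a::metric_space set \<Rightarrow> 'a \<Rightarrow> 'a \<Rightarrow> 'a set \<Rightarrow> bool" where
  "geodesic_segment T x y S \<longleftrightarrow>
    (\<exists>\<gamma> :: real \<Rightarrow> 'a.
      \<gamma> 0 = x \<and> \<gamma> (dist x y) = y \<and>
      (\<forall>s\<in>{0..dist x y}. \<forall>t\<in>{0..dist x y}. dist (\<gamma> s) (\<gamma> t) = \<bar>s - t\<bar>) \<and>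
      S = \<gamma> ` {0..dist x y} \<and> S \<subseteq> T)"

definition real_tree :: "'a::metric_space set \<Rightarrow> bool" where
  "real_tree T \<longleftrightarrow>
    T \<noteq> {} \<and>
    (\<forall>x\<in>T. \<forall>y\<in>T. \<exists>!S. geodesic_segment T x y S) \<and>
    (\<forall>x\<in>T. \<forall>y\<in>T. \<forall>z\<in>T. \<forall>S S'.
      geodesic_segment T x y S \<and> geodesic_segment T y z S' \<and> S \<inter> S' = {y}
        \<longrightarrow> geodesic_segment T x z (S \<union> S'))"

text \<open>A metric tree \<open>T\<close> with vertex set \<open>V\<close> is the geometric realization of a simplicial tree
  (edges of length 1, path metric): vertices are uniformly discrete, the closed edges and the
  vertices cover \<open>T\<close>, and open edges are open in \<open>T\<close>. The last condition forces distinct edges to meet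
  at most in a vertex and branching to occur only at vertices; the local topology at a vertex of
  infinite valence is the metric one.\<close>

definition is_edge :: "'a::metric_space set \<Rightarrow> 'a set \<Rightarrow> 'a set \<Rightarrow> bool" where
  "is_edge T V E \<longleftrightarrow> (\<exists>u\<in>V. \<exists>v\<in>V. dist u v = 1 \<and> geodesic_segment T u v E)"

definition simplicial_tree :: "'a::metric_space set \<Rightarrow> 'a set \<Rightarrow> bool" where
  "simplicial_tree T V \<longleftrightarrow>
    real_tree T \<and> V \<subseteq> T \<and>
    (\<forall>u\<in>V. \<forall>v\<in>V. u \<noteq> v \<longrightarrow> 1 \<le> dist u v) \<and>
    T = V \<union> \<Union>{E. is_edge T V E} \<and>
    (\<forall>E. is_edge T V E \<longrightarrow> openin (top_of_set T) (E - V))"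

text \<open>Vertices of the first barycentric subdivision.\<close>

definition subdivision_vertices :: "'a::metric_space set \<Rightarrow> 'a set \<Rightarrow> 'a set" where
  "subdivision_vertices T V =
    V \<union> {x \<in> T. \<exists>u\<in>V. \<exists>v\<in>V. dist u v = 1 \<and> dist u x = 1/2 \<and> dist x v = 1/2}"


section \<open>Isometric actions\<close>

definition isometric_action ::
    "('g, 'x) monoid_scheme \<Rightarrow> 'a::metric_space set \<Rightarrow> ('g \<Rightarrow> 'a \<Rightarrow> 'a) \<Rightarrow> bool" where
  "isometric_action G T \<phi> \<longleftrightarrow>
    group_action G T \<phi> \<and>
    (\<forall>g\<in>carrier G. \<forall>x\<in>T. \<forall>y\<in>T. dist (\<phi> g x) (\<phi> g y) = dist x y)"

text \<open>Subtrees of a metric tree are its nonempty connected subsets; they need not be unions of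
  simplices, since an isometry may invert an edge.\<close>

definition minimal_action ::
    "('g, 'x) monoid_scheme \<Rightarrow> 'a::metric_space set \<Rightarrow> ('g \<Rightarrow> 'a \<Rightarrow> 'a) \<Rightarrow> bool" where
  "minimal_action G T \<phi> \<longleftrightarrow>
    (\<forall>S. S \<subseteq> T \<and> S \<noteq> {} \<and> connected S \<and> (\<forall>g\<in>carrier G. \<phi> g ` S = S) \<longrightarrow> S = T)"

definition without_inversions ::
    "('g, 'x) monoid_scheme \<Rightarrow> 'a::metric_space set \<Rightarrow> ('g \<Rightarrow> 'a \<Rightarrow> 'a) \<Rightarrow> bool" where
  "without_inversions G V \<phi> \<longleftrightarrow>
    \<not> (\<exists>g\<in>carrier G. \<exists>u\<in>V. \<exists>v\<in>V. dist u v = 1 \<and> \<phi> g u = v \<and> \<phi> g v = u)"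

definition Fix :: "'a set \<Rightarrow> ('g \<Rightarrow> 'a \<Rightarrow> 'a) \<Rightarrow> 'g \<Rightarrow> 'a set" where
  "Fix T \<phi> g = {x \<in> T. \<phi> g x = x}"

definition line_by_translations ::
    "('g, 'x) monoid_scheme \<Rightarrow> 'a::metric_space set \<Rightarrow> ('g \<Rightarrow> 'a \<Rightarrow> 'a) \<Rightarrow> bool" where
  "line_by_translations G T \<phi> \<longleftrightarrow>
    (\<exists>f :: 'a \<Rightarrow> real.
      f ` T = UNIV \<and>
      (\<forall>x\<in>T. \<forall>y\<in>T. dist (f x) (f y) = dist x y) \<and>
      (\<forall>g\<in>carrier G. \<exists>t. \<forall>x\<in>T. f (\<phi> g x) = f x + t))"

text \<open>Stabilizer of the path with end points \<open>p\<close> and \<open>q\<close>: the elements fixing both.\<close>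

definition path_stabilizer ::
    "('g, 'x) monoid_scheme \<Rightarrow> ('g \<Rightarrow> 'a \<Rightarrow> 'a) \<Rightarrow> 'a \<Rightarrow> 'a \<Rightarrow> 'g set" where
  "path_stabilizer G \<phi> p q = stabilizer G \<phi> p \<inter> stabilizer G \<phi> q"

end

theory Submission
  imports Defs
begin

text \<open>
  Write \<open>x = a b\<close>, \<open>y = c b\<close>, \<open>\<Delta> = x^m a\<close> and \<open>D = y^n c\<close>. The braid relation of \<open>a\<close> and \<open>b\<close> says
  that conjugation by \<open>\<Delta>\<close> exchanges \<open>a\<close> and \<open>b\<close>, so \<open>\<Delta>^2 = x^(2m+1)\<close> is central in \<open>\<langle>a, b\<rangle>\<close>; the
  same holds for \<open>c\<close>, \<open>b\<close>, \<open>D\<close> and \<open>y\<close>. In particular \<open>a\<close>, \<open>b\<close> and \<open>c\<close> are conjugate.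
  Isometries of trees are studied through inequalities between distances: a real tree satisfies the
  four-point condition, and an isometry is either elliptic (it fixes a point) or hyperbolic (it translates an axis); an
  isometry that commutes with a hyperbolic one preserves its axis and translates it.

  If \<open>a\<close> is elliptic, then so is \<open>x\<close>: were \<open>x\<close> hyperbolic, \<open>a\<close> and \<open>b\<close> would commute with the
  hyperbolic element \<open>x^(2m+1)\<close> and translate its axis; being elliptic, they would fix it pointwise, and
  then so would \<open>x = a b\<close>. Since \<open>a\<close>, \<open>b\<close> and \<open>a b\<close> are elliptic, \<open>a\<close> and \<open>b\<close> have a common fixed
  point. So have \<open>c\<close>, \<open>b\<close>, and the commuting elements \<open>a\<close>, \<open>c\<close>. A median of three such points is fixed
  by all three generators (\<open>global_fixed_point\<close>), and minimality makes \<open>T\<close> that point.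

  If \<open>a\<close> and \<open>x\<close> are hyperbolic, the axis of the central element \<open>x^(2m+1)\<close> is also the axis of \<open>a\<close>;
  it is translated by \<open>a\<close> and \<open>b\<close>, and by \<open>c\<close>, which commutes with \<open>a\<close> (\<open>dihedral_line\<close>). By
  minimality \<open>T\<close> is this line. For hyperbolic \<open>y\<close> the roles of \<open>a\<close> and \<open>c\<close> are exchanged.

  Finally let \<open>a\<close> be hyperbolic and \<open>x\<close>, \<open>y\<close> elliptic. Then \<open>\<Delta>\<close> is elliptic, since its square is.
  The shortest path from a fixed point \<open>p\<close> of \<open>\<Delta>\<close> to a fixed point \<open>q\<close> of \<open>x\<close> lies on the axes of both
  \<open>a\<close> and \<open>b\<close> and is half a translation length long; \<open>a\<close> translates in the direction from \<open>p\<close> to \<open>q\<close>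
  and \<open>b\<close> in the direction from \<open>q\<close> to \<open>p\<close> (\<open>dihedral_bridge_exists\<close>). The pair \<open>c\<close>, \<open>b\<close> gives such a
  path from \<open>r\<close> to \<open>s\<close>. The commuting elements \<open>a\<close> and \<open>c\<close> have the same axis. Comparing the
  two paths on it and on the axis of \<open>b\<close> shows that \<open>a\<close> and \<open>c\<close> translate in the same direction,
  so they agree on the common axis, and this forces \<open>r = p\<close> and \<open>s = q\<close> (\<open>dihedral_bridges_agree\<close>).
  The listed stabilizers then follow by computing in the group.

  The images of \<open>p\<close> under the powers of \<open>x\<close> leave \<open>q\<close> in at least three directions, so \<open>q\<close> is a branch
  point and hence a vertex. As \<open>p\<close> is the midpoint of the vertices \<open>q\<close> and \<open>\<Delta> q\<close>, whose distance is
  an integer, it is a vertex or the midpoint of an edge, and in the latter case \<open>\<Delta>\<close> inverts that edge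
  (\<open>dihedral_bridge_vertices\<close>).
\<close>

section \<open>The four-point condition in a real tree\<close>

text \<open>Between points of different halves the path through \<open>p\<close> bounds the distance from above; a
  shorter connection would give one from \<open>x\<close> to \<open>y\<close> shorter than their distance.\<close>

lemma geodesic_segment_concat:
  assumes "geodesic_segment T x p S1" "geodesic_segment T p y S2"
    and d: "dist x p + dist p y = dist x y"
  shows "geodesic_segment T x y (S1 \<union> S2)"
proof -
  obtain g where g: "g 0 = x" "g (dist x p) = p" "S1 = g ` {0..dist x p}" "S1 \<subseteq> T"
    "\<And>s t. s \<in> {0..dist x p} \<Longrightarrow> t \<in> {0..dist x p} \<Longrightarrow> dist (g s) (g t) = \<bar>s - t\<bar>"
    using assms(1) unfolding geodesic_segment_def by blast
  obtain h where h: "h 0 = p" "h (dist p y) = y" "S2 = h ` {0..dist p y}" "S2 \<subseteq> T"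
    "\<And>s t. s \<in> {0..dist p y} \<Longrightarrow> t \<in> {0..dist p y} \<Longrightarrow> dist (h s) (h t) = \<bar>s - t\<bar>"
    using assms(2) unfolding geodesic_segment_def by blast
  define k where "k t = (if t \<le> dist x p then g t else h (t - dist x p))" for t
  have k1: "k t = g t" if "t \<le> dist x p" for t using that by (simp add: k_def)
  have k2: "k t = h (t - dist x p)" if "t \<ge> dist x p" for t
    using that g(2) h(1) by (cases "t = dist x p") (auto simp: k_def)
  have iso: "dist (k s) (k t) = \<bar>s - t\<bar>" if "0 \<le> s" "s \<le> t" "t \<le> dist x y" for s t
  proof -
    consider "t \<le> dist x p" | "s \<ge> dist x p" | "s \<le> dist x p" "t \<ge> dist x p" by linarith
    then show ?thesis
    proof cases
      case 1 then show ?thesis using that g(5)[of s t] by (simp add: k1)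
    next
      case 2 then show ?thesis using that d h(5)[of "s - dist x p" "t - dist x p"] by (simp add: k2)
    next
      case 3
      have "dist (k s) p = dist x p - s" "dist x (k s) = s"
        using 3 that g(5)[of s "dist x p"] g(5)[of 0 s] by (auto simp: k1 g)
      moreover have "dist p (k t) = t - dist x p" "dist (k t) y = dist x y - t"
        using 3 that d h(5)[of 0 "t - dist x p"] h(5)[of "t - dist x p" "dist p y"]
        by (auto simp: k2 h)
      moreover have "dist x y \<le> dist x (k s) + dist (k s) (k t) + dist (k t) y"
        using dist_triangle[of x y "k s"] dist_triangle[of "k s" y "k t"] by linarith
      ultimately show ?thesis
        using dist_triangle[of "k s" "k t" p] that by linarith
    qed
  qed
  have iso': "dist (k s) (k t) = \<bar>s - t\<bar>" if "s \<in> {0..dist x y}" "t \<in> {0..dist x y}" for s t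
    using iso[of s t] iso[of t s] that by (cases "s \<le> t") (auto simp: dist_commute)
  have im: "S1 \<union> S2 = k ` {0..dist x y}"
  proof -
    have "{0..dist x y} = {0..dist x p} \<union> {dist x p..dist x y}"
    proof (intro equalityI subsetI)
      fix t assume "t \<in> {0..dist x p} \<union> {dist x p..dist x y}"
      then show "t \<in> {0..dist x y}"
        using d zero_le_dist[of x p] zero_le_dist[of p y] unfolding Un_iff atLeastAtMost_iff by linarith
    next
      fix t assume "t \<in> {0..dist x y}"
      then show "t \<in> {0..dist x p} \<union> {dist x p..dist x y}"
        unfolding Un_iff atLeastAtMost_iff by linarith
    qed
    moreover have "k ` {0..dist x p} = S1" using g(3) k1 by auto
    moreover have "k ` {dist x p..dist x y} = S2"
    proof -
      have "{dist x p..dist x y} = (+) (dist x p) ` {0..dist p y}"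
        unfolding image_add_atLeastAtMost using d by (simp add: add.commute)
      then have "k ` {dist x p..dist x y} = (\<lambda>t. k (dist x p + t)) ` {0..dist p y}"
        by (simp only: image_image)
      also have "\<dots> = h ` {0..dist p y}"
        by (rule image_cong) (simp_all add: k2)
      finally show ?thesis using h(3) by simp
    qed
    ultimately show ?thesis by (simp add: image_Un)
  qed
  have "k 0 = x" using k1 g(1) by simp
  moreover have "k (dist x y) = y"
  proof -
    have "dist x y - dist x p = dist p y" "dist x p \<le> dist x y"
      using d zero_le_dist[of p y] by linarith+
    then show ?thesis using k2[of "dist x y"] h(2) by metis
  qed
  moreover have "k ` {0..dist x y} \<subseteq> T" using im g(4) h(4) by blast
  ultimately show ?thesis
    unfolding geodesic_segment_def using iso' im by blast
qed

lemma geodesic_segment_ends: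
  assumes "geodesic_segment T x y S" shows "x \<in> S" "y \<in> S" "x \<in> T" "y \<in> T" "S \<subseteq> T"
proof -
  obtain g where g: "g 0 = x" "g (dist x y) = y" "S = g ` {0..dist x y}" "S \<subseteq> T"
    using assms unfolding geodesic_segment_def by blast
  show "x \<in> S" unfolding g(3) by (rule image_eqI[of _ _ 0]) (simp_all add: g(1))
  show "y \<in> S" unfolding g(3) by (rule image_eqI[of _ _ "dist x y"]) (simp_all add: g(2))
  show "S \<subseteq> T" by (fact g(4))
  then show "x \<in> T" "y \<in> T" using \<open>x \<in> S\<close> \<open>y \<in> S\<close> by auto
qed

lemma geodesic_segment_between:
  assumes "geodesic_segment T x y S" "p \<in> S"
  shows "dist x p + dist p y = dist x y"
proof -
  obtain g where g: "g 0 = x" "g (dist x y) = y" "S = g ` {0..dist x y}"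
    "\<And>s t. s \<in> {0..dist x y} \<Longrightarrow> t \<in> {0..dist x y} \<Longrightarrow> dist (g s) (g t) = \<bar>s - t\<bar>"
    using assms(1) unfolding geodesic_segment_def by blast
  then obtain t where t: "t \<in> {0..dist x y}" "p = g t" using assms(2) by auto
  then show ?thesis using g(4)[of 0 t] g(4)[of t "dist x y"] g(1,2) by auto
qed

text \<open>The segments from \<open>x\<close> to \<open>p\<close> and from \<open>p\<close> to \<open>y\<close> concatenate to a geodesic, which uniqueness
  of geodesics identifies with \<open>S\<close>. So a segment is determined by distances alone.\<close>

lemma geodesic_segment_contains_between:
  assumes "real_tree T" "geodesic_segment T x y S" "p \<in> T" "dist x p + dist p y = dist x y"
  shows "p \<in> S"
proof -
  have xy: "x \<in> T" "y \<in> T" using geodesic_segment_ends[OF assms(2)] by auto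
  obtain S1 S2 where S: "geodesic_segment T x p S1" "geodesic_segment T p y S2"
    using assms(1,3) xy unfolding real_tree_def by meson
  then have "geodesic_segment T x y (S1 \<union> S2)"
    using assms(4) by (rule geodesic_segment_concat)
  then have "S = S1 \<union> S2" using assms(1,2) xy unfolding real_tree_def by blast
  then show ?thesis using geodesic_segment_ends[OF S(1)] by auto
qed

lemma geodesic_segment_point_unique:
  assumes "geodesic_segment T x y S" "p \<in> S" "q \<in> S" "dist x p = dist x q"
  shows "p = q"
proof -
  obtain g where g: "g 0 = x" "S = g ` {0..dist x y}"
    "\<And>s t. s \<in> {0..dist x y} \<Longrightarrow> t \<in> {0..dist x y} \<Longrightarrow> dist (g s) (g t) = \<bar>s - t\<bar>"
    using assms(1) unfolding geodesic_segment_def by blast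
  obtain s t where "s \<in> {0..dist x y}" "p = g s" "t \<in> {0..dist x y}" "q = g t"
    using assms(2,3) g(2) by auto
  then show ?thesis using g(3)[of 0 s] g(3)[of 0 t] g(1) assms(4) by auto
qed

text \<open>The segments from \<open>y\<close> to \<open>x\<close> and to \<open>z\<close> run together up to a last common point \<open>m\<close>. Beyond
  \<open>m\<close> they are disjoint, so the third axiom of a real tree joins their ends into a geodesic.\<close>

lemma real_tree_median:
  assumes T: "real_tree T" and xyz: "x \<in> T" "y \<in> T" "z \<in> T"
  shows "\<exists>m\<in>T. dist x m + dist m y = dist x y \<and> dist y m + dist m z = dist y z \<and>
    dist x m + dist m z = dist x z"
proof -
  obtain S S' where S: "geodesic_segment T y x S" "geodesic_segment T y z S'"
    using T xyz unfolding real_tree_def by meson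
  obtain g where g: "g 0 = y" "g (dist y x) = x" "S = g ` {0..dist y x}" "S \<subseteq> T"
    "\<And>s t. s \<in> {0..dist y x} \<Longrightarrow> t \<in> {0..dist y x} \<Longrightarrow> dist (g s) (g t) = \<bar>s - t\<bar>"
    using S(1) unfolding geodesic_segment_def by blast
  obtain h where h: "h 0 = y" "h (dist y z) = z" "S' = h ` {0..dist y z}" "S' \<subseteq> T"
    "\<And>s t. s \<in> {0..dist y z} \<Longrightarrow> t \<in> {0..dist y z} \<Longrightarrow> dist (h s) (h t) = \<bar>s - t\<bar>"
    using S(2) unfolding geodesic_segment_def by blast
  define A where "A = {t. 0 \<le> t \<and> t \<le> dist y x \<and> t \<le> dist y z \<and> g t = h t}"
  define s where "s = Sup A"
  have A0: "0 \<in> A" using g h by (simp add: A_def)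
  have bdd: "bdd_above A" unfolding A_def bdd_above_def by auto
  have s_ub: "t \<le> s" if "t \<in> A" for t unfolding s_def by (rule cSup_upper[OF that bdd])
  have s_range: "0 \<le> s" "s \<le> dist y x" "s \<le> dist y z"
  proof -
    show "0 \<le> s" by (rule s_ub[OF A0])
    have "A \<noteq> {}" using A0 by auto
    then have "Sup A \<le> b" if "\<And>t. t \<in> A \<Longrightarrow> t \<le> b" for b
      using that by (rule cSup_least)
    then show "s \<le> dist y x" "s \<le> dist y z" unfolding s_def A_def by blast+
  qed
  have gs: "g s = h s"
  proof (rule ccontr)
    assume ne: "g s \<noteq> h s"
    define e where "e = dist (g s) (h s) / 2"
    have "e > 0" using ne by (simp add: e_def)
    then obtain t where t: "t \<in> A" "t > s - e" using less_cSupD[of A "s - e"] A0 unfolding s_def by auto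
    have "t \<le> s" using s_ub t by auto
    then have "dist (g s) (g t) < e" "dist (h t) (h s) < e"
      using g(5)[of s t] h(5)[of t s] t s_range by (auto simp: A_def)
    moreover have "g t = h t" using t by (simp add: A_def)
    ultimately show False
      using dist_triangle[of "g s" "h s" "g t"] by (simp add: e_def)
  qed
  define m where "m = g s"
  have mT: "m \<in> T" using g(3,4) s_range by (auto simp: m_def)
  have m1: "dist y m = s" "dist y m + dist m x = dist y x"
    using g(5)[of 0 s] g(5)[of s "dist y x"] s_range g(1,2) by (auto simp: m_def)
  have m2: "dist y m + dist m z = dist y z"
    using h(5)[of 0 s] h(5)[of s "dist y z"] s_range h(1,2) by (auto simp: m_def gs)
  obtain U U' where U: "geodesic_segment T x m U" "geodesic_segment T m z U'"
    using T xyz mT unfolding real_tree_def by meson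
  have "U \<inter> U' = {m}"
  proof (intro equalityI subsetI)
    fix w assume w: "w \<in> U \<inter> U'"
    have wT: "w \<in> T" using w U geodesic_segment_ends(5) by blast
    have b: "dist x w + dist w m = dist x m" "dist m w + dist w z = dist m z"
      using w U geodesic_segment_between by blast+
    have c1: "dist y w + dist w x = dist y x" "dist y w = s + dist m w"
      using b m1 dist_triangle[of y x w] dist_triangle[of y w m] by (auto simp: dist_commute)
    have c2: "dist y w + dist w z = dist y z"
      using b m1 m2 dist_triangle[of y z w] dist_triangle[of y w m] by (auto simp: dist_commute)
    define t where "t = dist y w"
    have "0 \<le> t" "t \<le> dist y x" "t \<le> dist y z"
      using c1(1) c2 zero_le_dist[of w x] zero_le_dist[of w z] zero_le_dist[of y w]
      unfolding t_def by linarith+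
    note t = this
    have "dist y w = dist y (g t)" "dist y w = dist y (h t)"
      using g(5)[of 0 t] h(5)[of 0 t] t by (simp_all add: g(1) h(1) flip: t_def)
    moreover have "g t \<in> S" "h t \<in> S'" using t by (simp_all add: g(3) h(3))
    moreover have "w \<in> S" "w \<in> S'"
      using geodesic_segment_contains_between[OF T S(1) wT c1(1)]
        geodesic_segment_contains_between[OF T S(2) wT c2] by blast+
    ultimately have "w = g t" "w = h t"
      using geodesic_segment_point_unique[OF S(1)] geodesic_segment_point_unique[OF S(2)] by blast+
    then have "g t = h t" by simp
    then have "t \<in> A" using t by (simp add: A_def)
    then have "dist m w \<le> 0" using s_ub[of t] c1(2) by (simp add: t_def)
    then show "w \<in> {m}" by simp
  next
    fix w assume "w \<in> {m}"
    then show "w \<in> U \<inter> U'" using geodesic_segment_ends[OF U(1)] geodesic_segment_ends[OF U(2)] by auto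
  qed
  then have "geodesic_segment T x z (U \<union> U')"
    using T U xyz mT unfolding real_tree_def by blast
  then have "dist x m + dist m z = dist x z"
    by (rule geodesic_segment_between) (use geodesic_segment_ends[OF U(1)] in auto)
  then show ?thesis using mT m1 m2 by (intro bexI[of _ m]) (auto simp: dist_commute)
qed

text \<open>The condition becomes additive at the medians of \<open>x, y, w\<close> and of \<open>z, y, w\<close>, which both lie on
  the segment from \<open>y\<close> to \<open>w\<close>.\<close>

lemma real_tree_four_point:
  assumes T: "real_tree T" and "x \<in> T" "y \<in> T" "z \<in> T" "w \<in> T"
  shows "dist x z + dist y w \<le> max (dist x y + dist z w) (dist x w + dist y z)"
proof -
  obtain p where p: "p \<in> T" "dist x p + dist p y = dist x y" "dist y p + dist p w = dist y w"
      "dist x p + dist p w = dist x w"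
    using real_tree_median[OF T assms(2,3,5)] by blast
  obtain q where q: "q \<in> T" "dist z q + dist q y = dist z y" "dist y q + dist q w = dist y w"
      "dist z q + dist q w = dist z w"
    using real_tree_median[OF T assms(4,3,5)] by blast
  \<comment> \<open>Both medians lie on the segment from \<open>y\<close> to \<open>w\<close>, at the distance from each other that
    their positions say.\<close>
  have pq: "dist p q = \<bar>dist y p - dist y q\<bar>"
  proof -
    obtain S where S: "geodesic_segment T y w S" using T assms unfolding real_tree_def by meson
    obtain g where g: "g 0 = y" "S = g ` {0..dist y w}"
      "\<And>s t. s \<in> {0..dist y w} \<Longrightarrow> t \<in> {0..dist y w} \<Longrightarrow> dist (g s) (g t) = \<bar>s - t\<bar>"
      using S(1) unfolding geodesic_segment_def by blast
    have "p \<in> S" "q \<in> S" using geodesic_segment_contains_between[OF T S] p(1,3) q(1,3) by blast+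
    then obtain s t where "s \<in> {0..dist y w}" "p = g s" "t \<in> {0..dist y w}" "q = g t"
      using g(2) by auto
    then show ?thesis using g(3)[of 0 s] g(3)[of 0 t] g(3)[of s t] by (simp add: g(1))
  qed
  have "dist x z \<le> dist x p + dist p q + dist z q"
    using dist_triangle[of x z p] dist_triangle[of p z q] dist_commute[of q z] by linarith
  then have "dist x z + dist y w \<le> dist x y + dist z w \<or> dist x z + dist y w \<le> dist x w + dist y z"
    using pq p(2-4) q(2-4) dist_commute[of p y] dist_commute[of q y] dist_commute[of z y]
    by linarith
  then show ?thesis by linarith
qed

section \<open>Trees and their isometries in terms of distances\<close>

text \<open>Points at prescribed positions between two given points and the four-point condition are all that
  the study of isometries uses of a tree; both speak of distances only, so most arguments below reduce
  to linear arithmetic.\<close>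

locale metric_tree =
  fixes T :: "'a::metric_space set"
  assumes segment_point: "\<lbrakk>x \<in> T; y \<in> T; 0 \<le> t; t \<le> dist x y\<rbrakk>
      \<Longrightarrow> \<exists>p\<in>T. dist x p = t \<and> dist p y = dist x y - t"
    and four_point: "\<lbrakk>x \<in> T; y \<in> T; z \<in> T; w \<in> T\<rbrakk>
      \<Longrightarrow> dist x z + dist y w \<le> max (dist x y + dist z w) (dist x w + dist y z)"
begin

definition mid :: "'a \<Rightarrow> 'a \<Rightarrow> 'a \<Rightarrow> bool" where
  "mid p x y \<longleftrightarrow> p \<in> T \<and> dist x p = dist x y / 2 \<and> dist p y = dist x y / 2"

lemma between_dist:
  assumes "x \<in> T" "y \<in> T" "p \<in> T" "q \<in> T"
    and "dist x p + dist p y = dist x y" "dist x q + dist q y = dist x y"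
  shows "dist p q = \<bar>dist x p - dist x q\<bar>"
  using four_point[of x p y q] assms dist_triangle[of x p q] dist_triangle[of x q p]
  by (auto simp: dist_commute max_def split: if_splits)

lemma mid_exists: "x \<in> T \<Longrightarrow> y \<in> T \<Longrightarrow> \<exists>p. mid p x y"
  using segment_point[of x y "dist x y / 2"] by (auto simp: mid_def)

lemma mid_unique: "x \<in> T \<Longrightarrow> y \<in> T \<Longrightarrow> mid p x y \<Longrightarrow> mid q x y \<Longrightarrow> p = q"
  using between_dist[of x y p q] unfolding mid_def
  by (metis abs_zero diff_self dist_eq_0_iff field_sum_of_halves)

lemma mid_commute: "mid p x y \<longleftrightarrow> mid p y x"
  by (auto simp: mid_def dist_commute)

lemma mid_in: "mid p x y \<Longrightarrow> p \<in> T"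
  by (simp add: mid_def)

text \<open>The position of \<open>m\<close> on the segment from \<open>x\<close> to \<open>y\<close> is the Gromov product of \<open>y\<close> and \<open>z\<close> at \<open>x\<close>.\<close>

lemma median:
  assumes "x \<in> T" "y \<in> T" "z \<in> T"
  shows "\<exists>m\<in>T. dist x m + dist m y = dist x y \<and> dist y m + dist m z = dist y z \<and>
    dist x m + dist m z = dist x z"
proof -
  define t where "t = (dist x y + dist x z - dist y z) / 2"
  have "0 \<le> t" "t \<le> dist x y"
    using dist_triangle[of y z x] dist_triangle[of x z y] by (auto simp: t_def dist_commute)
  then obtain m where m: "m \<in> T" "dist x m = t" "dist m y = dist x y - t"
    using segment_point assms by blast
  have "dist m z \<le> dist x z - t"
  proof -
    have "dist m z + dist x y \<le> dist m x + dist z y \<or> dist m z + dist x y \<le> dist m y + dist x z"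
      using four_point[of m x z y] m(1) assms by (simp add: le_max_iff_disj)
    then show ?thesis
      using m dist_commute[of m x] dist_commute[of z y] by (auto simp: t_def field_simps)
  qed
  then show ?thesis
    using m dist_triangle[of x z m] by (intro bexI[of _ m]) (auto simp: dist_commute t_def field_simps)
qed

end

lemma real_tree_metric_tree:
  assumes "real_tree T"
  shows "metric_tree T"
proof
  fix x y t assume xy: "x \<in> T" "y \<in> T" "0 \<le> t" "t \<le> dist x y"
  obtain S where S: "geodesic_segment T x y S" using assms xy unfolding real_tree_def by meson
  then obtain g where g: "g 0 = x" "g (dist x y) = y" "S = g ` {0..dist x y}" "S \<subseteq> T"
    "\<And>s t. s \<in> {0..dist x y} \<Longrightarrow> t \<in> {0..dist x y} \<Longrightarrow> dist (g s) (g t) = \<bar>s - t\<bar>"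
    unfolding geodesic_segment_def by blast
  show "\<exists>p\<in>T. dist x p = t \<and> dist p y = dist x y - t"
    using g(5)[of 0 t] g(5)[of t "dist x y"] g(1-4) xy by (intro bexI[of _ "g t"]) auto
qed (rule real_tree_four_point[OF assms])

locale tree_action = metric_tree T + group G
  for T :: "'a::metric_space set" and G :: "('g, 'x) monoid_scheme" (structure) +
  fixes \<phi> :: "'g \<Rightarrow> 'a \<Rightarrow> 'a"
  assumes act_in [simp]: "\<lbrakk>g \<in> carrier G; x \<in> T\<rbrakk> \<Longrightarrow> \<phi> g x \<in> T"
    and act_mult [simp]: "\<lbrakk>g \<in> carrier G; h \<in> carrier G; x \<in> T\<rbrakk> \<Longrightarrow> \<phi> (g \<otimes> h) x = \<phi> g (\<phi> h x)"
    and act_one [simp]: "x \<in> T \<Longrightarrow> \<phi> \<one> x = x"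
    and act_dist [simp]:
      "\<lbrakk>g \<in> carrier G; x \<in> T; y \<in> T\<rbrakk> \<Longrightarrow> dist (\<phi> g x) (\<phi> g y) = dist x y"
begin

definition elliptic :: "'g \<Rightarrow> bool" where
  "elliptic g \<longleftrightarrow> (\<exists>x\<in>T. \<phi> g x = x)"

text \<open>For \<open>g\<close> without fixed points this is the translation axis: \<open>z\<close> lies on it exactly if the
  segments from \<open>z\<close> to \<open>g z\<close> and from \<open>g z\<close> to \<open>g (g z)\<close> do not backtrack.\<close>

definition axis :: "'g \<Rightarrow> 'a set" where
  "axis g = {z \<in> T. dist z (\<phi> g (\<phi> g z)) = 2 * dist z (\<phi> g z)}"

lemma axis_in: "z \<in> axis g \<Longrightarrow> z \<in> T"
  by (simp add: axis_def)

lemma act_inv_act [simp]: "g \<in> carrier G \<Longrightarrow> x \<in> T \<Longrightarrow> \<phi> (inv g) (\<phi> g x) = x"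
  using act_mult[of "inv g" g x] by (simp del: act_mult)

lemma act_act_inv [simp]: "g \<in> carrier G \<Longrightarrow> x \<in> T \<Longrightarrow> \<phi> g (\<phi> (inv g) x) = x"
  using act_mult[of g "inv g" x] by (simp del: act_mult)

lemma act_eq_iff [simp]:
  "g \<in> carrier G \<Longrightarrow> x \<in> T \<Longrightarrow> y \<in> T \<Longrightarrow> \<phi> g x = \<phi> g y \<longleftrightarrow> x = y"
  by (metis act_inv_act)

lemma act_commute:
  "\<lbrakk>g \<otimes> h = h \<otimes> g; g \<in> carrier G; h \<in> carrier G; x \<in> T\<rbrakk> \<Longrightarrow> \<phi> g (\<phi> h x) = \<phi> h (\<phi> g x)"
  by (metis act_mult)

lemma fixed_pow: "g \<in> carrier G \<Longrightarrow> x \<in> T \<Longrightarrow> \<phi> g x = x \<Longrightarrow> \<phi> (g [^] (k::nat)) x = x"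
  by (induction k) auto

lemma fixed_inv: "g \<in> carrier G \<Longrightarrow> x \<in> T \<Longrightarrow> \<phi> g x = x \<Longrightarrow> \<phi> (inv g) x = x"
  by (metis act_inv_act)

lemma mid_act [simp]:
  "\<lbrakk>g \<in> carrier G; p \<in> T; x \<in> T; y \<in> T\<rbrakk> \<Longrightarrow> mid (\<phi> g p) (\<phi> g x) (\<phi> g y) \<longleftrightarrow> mid p x y"
  by (simp add: mid_def)

lemma fixed_between:
  assumes "g \<in> carrier G" "x \<in> T" "y \<in> T" "p \<in> T"
    and "\<phi> g x = x" "\<phi> g y = y" and d: "dist x p + dist p y = dist x y"
  shows "\<phi> g p = p"
proof -
  have "dist x (\<phi> g p) = dist x p" "dist (\<phi> g p) y = dist p y"
    using act_dist[of g x p] act_dist[of g p y] assms by auto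
  then show ?thesis using between_dist[of x y p "\<phi> g p"] assms by auto
qed

text \<open>The midpoint \<open>m\<close> is the projection of \<open>z\<close> to the set of fixed points of \<open>g\<close>: the segments from
  the fixed point \<open>w\<close> to \<open>z\<close> and to \<open>g z\<close> have equal lengths and part exactly at \<open>m\<close>.\<close>

lemma elliptic_mid:
  assumes g: "g \<in> carrier G" and w: "w \<in> T" "\<phi> g w = w" and z: "z \<in> T" and m: "mid m z (\<phi> g z)"
  shows "\<phi> g m = m" "dist w z = dist w m + dist m z"
proof -
  define w' where "w' = \<phi> g z"
  have r: "dist w w' = dist w z" using act_dist[of g w z] g w z by (simp add: w'_def)
  have T: "w' \<in> T" "m \<in> T" using g z m by (simp_all add: w'_def mid_def)
  have D: "dist z m = dist z w' / 2" "dist m w' = dist z w' / 2"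
    using m by (simp_all add: mid_def w'_def)
  show 1: "dist w z = dist w m + dist m z"
    using four_point[of w z m w'] w z T r D dist_triangle[of w z m]
    by (auto simp: dist_commute max_def split: if_splits)
  have "dist w w' = dist w m + dist m w'"
    using 1 r D by (simp add: dist_commute)
  moreover have "dist w w' = dist w (\<phi> g m) + dist (\<phi> g m) w'"
    using 1 r act_dist[of g w m] act_dist[of g m z] g w z T by (simp add: w'_def)
  moreover have "dist w (\<phi> g m) = dist w m" using act_dist[of g w m] g w z T by simp
  ultimately show "\<phi> g m = m" using between_dist[of w w' m "\<phi> g m"] w T g by simp
qed

text \<open>If \<open>g (g z)\<close> is no farther from \<open>z\<close> than \<open>g z\<close>, the segments from \<open>g z\<close> back to \<open>z\<close> and on to
  \<open>g (g z)\<close> share at least their first halves, so their midpoints \<open>m\<close> and \<open>g m\<close> coincide. This is the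
  dichotomy between elliptic and hyperbolic isometries.\<close>

lemma mid_fixed_of_short_double:
  assumes g: "g \<in> carrier G" and z: "z \<in> T" and m: "mid m z (\<phi> g z)"
    and le: "dist z (\<phi> g (\<phi> g z)) \<le> dist z (\<phi> g z)"
  shows "\<phi> g m = m"
proof -
  define z1 z2 where "z1 = \<phi> g z" and "z2 = \<phi> g z1"
  have T: "z1 \<in> T" "z2 \<in> T" "m \<in> T" using g z m by (simp_all add: z1_def z2_def mid_def)
  have D: "dist z m = dist z z1 / 2" "dist m z1 = dist z z1 / 2" "dist z1 z2 = dist z z1"
    using m g z by (simp_all add: mid_def z1_def z2_def)
  have "dist m z2 \<le> dist z z1 / 2"
    using four_point[of m z1 z2 z] four_point[of m z z2 z1] T z D le dist_triangle[of z1 z2 m]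
    by (auto simp: z1_def[symmetric] z2_def[symmetric] dist_commute max_def split: if_splits)
  then have "mid m z1 z2"
    using D T dist_triangle[of z1 z2 m] by (auto simp: mid_def dist_commute)
  moreover have "mid (\<phi> g m) z1 z2"
    using m g z T by (simp add: z1_def z2_def)
  ultimately show ?thesis using mid_unique T by blast
qed

lemma hyperbolic_double:
  assumes "g \<in> carrier G" "\<not> elliptic g" "z \<in> T"
  shows "dist z (\<phi> g z) < dist z (\<phi> g (\<phi> g z))"
  using mid_exists[of z "\<phi> g z"] mid_fixed_of_short_double[of g z] assms
  by (metis act_in elliptic_def mid_in not_less)

lemma elliptic_double:
  assumes g: "g \<in> carrier G" "elliptic g" and z: "z \<in> T"
  shows "dist z (\<phi> g (\<phi> g z)) \<le> dist z (\<phi> g z)"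
proof -
  obtain m where m: "mid m z (\<phi> g z)" using mid_exists g z by force
  obtain w where "w \<in> T" "\<phi> g w = w" using g by (auto simp: elliptic_def)
  then have "\<phi> g m = m" using elliptic_mid m g z by blast
  then have "dist m (\<phi> g (\<phi> g z)) = dist m (\<phi> g z)"
    using act_dist[of g m "\<phi> g z"] g z m by (simp add: mid_def)
  then show ?thesis
    using m dist_triangle[of z "\<phi> g (\<phi> g z)" m] by (simp add: mid_def)
qed

lemma elliptic_of_square:
  assumes "g \<in> carrier G" "elliptic (g \<otimes> g)"
  shows "elliptic g"
proof (rule ccontr)
  assume n: "\<not> elliptic g"
  obtain w where "w \<in> T" "\<phi> g (\<phi> g w) = w" using assms by (auto simp: elliptic_def)
  then show False using hyperbolic_double[OF assms(1) n, of w] by (simp add: not_less)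
qed

text \<open>With \<open>D\<close> and \<open>D2\<close> the distances from \<open>z\<close> to \<open>g z\<close> and to \<open>g (g z)\<close>, the midpoint \<open>m\<close> is moved
  by \<open>D2 - D > 0\<close>, and the part of the segment from \<open>z\<close> to \<open>g z\<close> that backtracks is too short to
  reach \<open>m\<close>.\<close>

lemma mid_in_axis:
  assumes g: "g \<in> carrier G" and hyp: "\<not> elliptic g" and z: "z \<in> T" and m: "mid m z (\<phi> g z)"
  shows "m \<in> axis g"
proof -
  define z1 z2 z3 m1 m2 where "z1 = \<phi> g z" and "z2 = \<phi> g z1" and "z3 = \<phi> g z2"
    and "m1 = \<phi> g m" and "m2 = \<phi> g m1"
  note defs = z1_def z2_def z3_def m1_def m2_def
  have T: "z1 \<in> T" "z2 \<in> T" "z3 \<in> T" "m \<in> T" "m1 \<in> T" "m2 \<in> T"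
    using g z m by (simp_all add: defs mid_def)
  define D D2 where "D = dist z z1" and "D2 = dist z z2"
  have D: "dist z z1 = D" "dist z1 z2 = D" "dist z2 z3 = D" "dist z z2 = D2" "dist z1 z3 = D2"
    using g z by (simp_all add: defs D_def D2_def)
  have M: "dist z m = D/2" "dist m z1 = D/2" "dist z1 m1 = D/2" "dist m1 z2 = D/2"
    "dist z2 m2 = D/2" "dist m2 z3 = D/2"
    using g z m by (simp_all add: defs mid_def D_def)
  have gt: "D < D2" using hyperbolic_double[OF g hyp z] by (simp add: D_def D2_def defs)
  have "dist m z2 = D2 - D/2"
    using four_point[of m z z2 z1] dist_triangle[of z z2 m] T z D M gt
    by (auto simp: dist_commute max_def split: if_splits)
  then have e: "dist m m1 = D2 - D"
    using four_point[of m z1 m1 z2] dist_triangle[of m z2 m1] T z D M gt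
    by (auto simp: dist_commute max_def split: if_splits)
  then have e': "dist m1 m2 = D2 - D" using g T by (simp add: defs)
  have "dist z z3 \<ge> 2 * D2 - D"
    using four_point[of z z1 z2 z3] T z D gt by (auto simp: dist_commute max_def split: if_splits)
  then have "dist m m2 \<ge> 2 * (D2 - D)"
    using dist_triangle[of z z3 m] dist_triangle[of m z3 m2] M(1,6) by argo
  then have "dist m m2 = 2 * dist m m1" using e e' dist_triangle[of m m2 m1] by simp
  then show ?thesis using T by (simp add: axis_def defs)
qed

lemma axis_nonempty: "g \<in> carrier G \<Longrightarrow> \<not> elliptic g \<Longrightarrow> z \<in> T \<Longrightarrow> axis g \<noteq> {}"
  using mid_exists[of z "\<phi> g z"] mid_in_axis[of g z] by auto

lemma axis_act_commute:
  assumes "g \<in> carrier G" "h \<in> carrier G" "h \<otimes> g = g \<otimes> h" "z \<in> axis g"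
  shows "\<phi> h z \<in> axis g"
proof -
  have "\<phi> g (\<phi> h z) = \<phi> h (\<phi> g z)" "\<phi> g (\<phi> h (\<phi> g z)) = \<phi> h (\<phi> g (\<phi> g z))"
    using assms axis_in[OF assms(4)] by (auto intro: act_commute)
  then show ?thesis using assms axis_in[OF assms(4)] by (simp add: axis_def)
qed

text \<open>A path that does not backtrack locally is a geodesic: the four-point condition for \<open>z\<close>, \<open>g z\<close>,
  \<open>g^(k+1) z\<close> and \<open>g^(k+2) z\<close> gives the induction step, which therefore needs two consecutive powers
  in the induction hypothesis.\<close>

lemma axis_pow:
  assumes g: "g \<in> carrier G" and hyp: "\<not> elliptic g" and z: "z \<in> axis g"
  shows "dist z (\<phi> (g [^] (k::nat)) z) = real k * dist z (\<phi> g z)"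
proof -
  define D where "D = dist z (\<phi> g z)"
  have zT: "z \<in> T" using z by (rule axis_in)
  have "D > 0" using hyp zT by (auto simp: D_def elliptic_def)
  have "dist z (\<phi> (g [^] k) z) = real k * D \<and> dist z (\<phi> (g [^] Suc k) z) = real (Suc k) * D"
  proof (induction k)
    case 0 then show ?case using g zT by (simp add: D_def)
  next
    case (Suc k)
    define u v w where "u = \<phi> g z" and "v = \<phi> (g [^] Suc k) z" and "w = \<phi> (g [^] Suc (Suc k)) z"
    have T: "u \<in> T" "v \<in> T" "w \<in> T" using g zT by (simp_all only: u_def v_def w_def act_in nat_pow_closed)
    have w: "w = \<phi> g v"
      unfolding w_def v_def nat_pow_Suc2[OF g, of "Suc k"] using g zT by (simp del: nat_pow_Suc)
    have v': "v = \<phi> g (\<phi> (g [^] k) z)"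
      unfolding v_def nat_pow_Suc2[OF g, of "k"] using g zT by (simp del: nat_pow_Suc)
    have w': "w = \<phi> (g [^] Suc k) u"
      unfolding w_def u_def nat_pow_Suc[of _ "Suc k"] using g zT by (simp del: nat_pow_Suc)
    have ih: "dist z v = (real k + 1) * D" using Suc by (simp add: v_def algebra_simps)
    have uv: "dist u v = real k * D" using Suc g zT by (simp add: u_def v')
    have vw: "dist v w = D" unfolding w' v_def using g zT by (simp add: u_def D_def del: nat_pow_Suc)
    have uw: "dist u w = (real k + 1) * D" using ih T g zT by (simp add: u_def w)
    have zu: "dist z u = D" by (simp add: u_def D_def)
    have "dist z w \<ge> (real k + 2) * D"
    proof (cases k)
      case 0
      then have "v = u" using g zT by (simp add: u_def v_def)
      then have "w = \<phi> g (\<phi> g z)" using w u_def by simp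
      then show ?thesis using z 0 by (simp add: axis_def D_def)
    next
      case (Suc j)
      have "real k * D > 0" using Suc \<open>D > 0\<close> by simp
      then have "D + D < 2 * ((real k + 1) * D)" using \<open>D > 0\<close> by (simp add: algebra_simps)
      then have "2 * ((real k + 1) * D) \<le> dist z w + real k * D"
        using four_point[of z u v w] T zT ih uv vw uw zu
        by (simp add: le_max_iff_disj) argo
      then show ?thesis by (simp add: algebra_simps)
    qed
    moreover have "dist z w \<le> (real k + 2) * D"
      using dist_triangle[of z w v] ih vw by (simp add: algebra_simps)
    ultimately show ?case using Suc by (simp add: w_def algebra_simps del: nat_pow_Suc)
  qed
  then show ?thesis by (simp add: D_def)
qed

text \<open>Different displacements of \<open>z\<close> and \<open>w\<close> would let their orbits drift apart without bound, but
  \<open>g^k z\<close> and \<open>g^k w\<close> always have the distance of \<open>z\<close> and \<open>w\<close>.\<close>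

lemma axis_displacement_le:
  assumes g: "g \<in> carrier G" and hyp: "\<not> elliptic g" and z: "z \<in> axis g" and w: "w \<in> axis g"
  shows "dist z (\<phi> g z) \<le> dist w (\<phi> g w)"
proof (rule ccontr)
  assume n: "\<not> ?thesis"
  define e where "e = dist z (\<phi> g z) - dist w (\<phi> g w)"
  have "e > 0" using n by (simp add: e_def)
  then obtain k :: nat where k: "2 * dist z w < real k * e" using reals_Archimedean3 by blast
  have T: "z \<in> T" "w \<in> T" "\<phi> (g [^] k) z \<in> T" "\<phi> (g [^] k) w \<in> T"
    using axis_in[OF z] axis_in[OF w] g by auto
  have "dist (\<phi> (g [^] k) z) (\<phi> (g [^] k) w) = dist z w" using T g by simp
  then have "real k * dist z (\<phi> g z) \<le> real k * dist w (\<phi> g w) + 2 * dist z w"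
    using axis_pow[OF g hyp z, of k] axis_pow[OF g hyp w, of k]
      dist_triangle[of z "\<phi> (g [^] k) z" w] dist_triangle[of w "\<phi> (g [^] k) z" "\<phi> (g [^] k) w"]
    by (simp add: dist_commute)
  then show False using k by (simp add: e_def algebra_simps)
qed

definition line_coord :: "'a set \<Rightarrow> ('a \<Rightarrow> real) \<Rightarrow> bool" where
  "line_coord L f \<longleftrightarrow> L \<subseteq> T \<and> f ` L = UNIV \<and> (\<forall>x\<in>L. \<forall>y\<in>L. dist x y = \<bar>f x - f y\<bar>)"

definition shift :: "'a set \<Rightarrow> ('a \<Rightarrow> real) \<Rightarrow> 'g \<Rightarrow> real \<Rightarrow> bool" where
  "shift L f g \<sigma> \<longleftrightarrow> (\<forall>x\<in>L. \<phi> g x \<in> L \<and> f (\<phi> g x) = f x + \<sigma>)"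

text \<open>For a point \<open>z\<close> of the axis, the segments from \<open>g^(-N) z\<close> to \<open>g^N z\<close> exhaust the axis. The
  coordinate of a point \<open>w\<close> on such a segment is its distance from the left end, normalized to be \<open>0\<close>
  at \<open>z\<close>; it does not depend on \<open>N\<close>.\<close>

lemma axis_line_coord_exists:
  assumes g: "g \<in> carrier G" and hyp: "\<not> elliptic g" and ne: "T \<noteq> {}"
  shows "\<exists>f \<tau>. \<tau> > 0 \<and> line_coord (axis g) f \<and> shift (axis g) f g \<tau>"
proof -
  obtain z where z: "z \<in> axis g" using axis_nonempty[OF g hyp] ne by blast
  have zT: "z \<in> T" by (rule axis_in[OF z])
  define \<tau> where "\<tau> = dist z (\<phi> g z)"
  have \<tau>: "\<tau> > 0" using hyp zT by (auto simp: \<tau>_def elliptic_def)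
  define zs where "zs i = \<phi> (g [^] (i::int)) z" for i
  have zsT: "zs i \<in> T" for i using g zT by (simp add: zs_def)
  have zs_add: "\<phi> (g [^] i) (zs j) = zs (i + j)" for i j :: int
    unfolding zs_def int_pow_mult[OF g] using g zT by simp
  have g_zs: "\<phi> g (zs j) = zs (j + 1)" for j
    using zs_add[of 1 j] g by (simp add: add.commute)
  have zs_dist: "dist (zs i) (zs j) = \<tau> * (j - i)" if "i \<le> j" for i j
  proof -
    have "dist (zs i) (zs j) = dist (\<phi> (g [^] i) (zs 0)) (\<phi> (g [^] i) (zs (j - i)))"
      by (simp add: zs_add)
    also have "\<dots> = dist (zs 0) (zs (j - i))" using g zsT by simp
    also have "\<dots> = dist z (\<phi> (g [^] nat (j - i)) z)"
      using that zT int_pow_int[of G g "nat (j - i)"] by (simp add: zs_def)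
    also have "\<dots> = real (nat (j - i)) * \<tau>" using axis_pow[OF g hyp z] by (simp add: \<tau>_def)
    finally show ?thesis using that by (simp add: mult.commute)
  qed
  define on where "on N w \<longleftrightarrow> w \<in> T \<and> dist (zs (- int N)) w + dist w (zs (int N)) = 2 * \<tau> * N" for N w
  define co where "co N w = dist (zs (- int N)) w - \<tau> * N" for N w
  have mono: "on M w \<and> co M w = co N w" if "on N w" "N \<le> M" for N M w
  proof -
    have "dist (zs (- int M)) (zs (- int N)) = \<tau> * M - \<tau> * N"
      "dist (zs (int N)) (zs (int M)) = \<tau> * M - \<tau> * N"
      "dist (zs (- int M)) (zs (int M)) = 2 * \<tau> * M"
      using that(2) by (simp_all add: zs_dist algebra_simps)
    then show ?thesis
      using that(1) dist_triangle[of "zs (- int M)" w "zs (- int N)"]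
        dist_triangle[of w "zs (int M)" "zs (int N)"]
        dist_triangle[of "zs (- int M)" "zs (int M)" w]
      by (simp add: on_def co_def)
  qed
  have co_dist: "dist v w = \<bar>co N v - co N w\<bar>" if "on N v" "on N w" for N v w
    using that between_dist[of "zs (- int N)" "zs (int N)" v w] zsT
      zs_dist[of "- int N" "int N"] by (simp add: on_def co_def)
  have step: "on (Suc N) (\<phi> g w) \<and> co (Suc N) (\<phi> g w) = co N w + \<tau>" if "on N w" for N w
  proof -
    have w: "w \<in> T" using that by (simp add: on_def)
    have "dist (zs (1 - int N)) (\<phi> g w) = dist (zs (- int N)) w"
      "dist (\<phi> g w) (zs (1 + int N)) = dist w (zs (int N))"
      using g_zs[of "- int N"] g_zs[of "int N"] act_dist[of g "zs (- int N)" w]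
        act_dist[of g w "zs (int N)"] g w zsT by (simp_all add: add.commute)
    moreover have "dist (zs (- 1 - int N)) (zs (1 - int N)) = 2 * \<tau>"
      "dist (zs (- 1 - int N)) (zs (1 + int N)) = 2 * \<tau> * N + 2 * \<tau>"
      by (simp_all add: zs_dist algebra_simps)
    ultimately show ?thesis
      using that g w dist_triangle[of "zs (- 1 - int N)" "\<phi> g w" "zs (1 - int N)"]
        dist_triangle[of "zs (- 1 - int N)" "zs (1 + int N)" "\<phi> g w"]
      by (simp add: on_def co_def algebra_simps)
  qed
  have on_axis: "w \<in> axis g" if "on N w" for N w
  proof -
    have "on (Suc (Suc N)) w" "on (Suc (Suc N)) (\<phi> g w)" "on (Suc (Suc N)) (\<phi> g (\<phi> g w))"
      "co (Suc (Suc N)) (\<phi> g w) = co (Suc (Suc N)) w + \<tau>"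
      "co (Suc (Suc N)) (\<phi> g (\<phi> g w)) = co (Suc (Suc N)) w + 2 * \<tau>"
      using mono[OF that, of "Suc N"] mono[OF that, of "Suc (Suc N)"] step[OF that]
        mono[of "Suc N" "\<phi> g w" "Suc (Suc N)"] step[of "Suc N" "\<phi> g w"] by simp_all
    then show ?thesis
      using co_dist[of "Suc (Suc N)" w "\<phi> g w"] co_dist[of "Suc (Suc N)" w "\<phi> g (\<phi> g w)"] \<tau>
      by (simp add: axis_def on_def)
  qed
  have axis_on: "\<exists>N. on N w" if w: "w \<in> axis g" for w
  proof -
    have wT: "w \<in> T" by (rule axis_in[OF w])
    define C where "C = dist z w"
    obtain N :: nat where N: "C < real N * \<tau>" using reals_Archimedean3[OF \<tau>] by blast
    define ws where "ws i = \<phi> (g [^] (i::int)) w" for i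
    have wsT: "ws i \<in> T" for i using g wT by (simp add: ws_def)
    have C: "dist (zs i) (ws i) = C" for i using g wT zT by (simp add: zs_def ws_def C_def)
    have \<tau>w: "dist w (\<phi> g w) = \<tau>"
      using axis_displacement_le[OF g hyp z w] axis_displacement_le[OF g hyp w z] by (simp add: \<tau>_def)
    have r: "dist w (ws (int k)) = \<tau> * k" for k :: nat
      using axis_pow[OF g hyp w, of k] \<tau>w by (simp add: ws_def int_pow_int)
    have l: "dist (ws (- int k)) w = \<tau> * k" for k :: nat
    proof -
      have "\<phi> (g [^] int k) (ws (- int k)) = w"
        using g wT act_mult[of "g [^] int k" "g [^] (- int k)" w]
        by (simp add: ws_def int_pow_mult[OF g, symmetric] del: act_mult)
      then have "dist (ws (- int k)) w = dist w (ws (int k))"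
        using act_dist[of "g [^] int k" "ws (- int k)" w] g wT wsT by (simp add: ws_def)
      then show ?thesis by (simp add: r)
    qed
    have lr: "dist (ws (- int N)) (ws (int N)) = 2 * \<tau> * N"
    proof -
      have "\<phi> (g [^] int N) (ws (- int N)) = w" "\<phi> (g [^] int N) (ws (int N)) = ws (int (2 * N))"
        using g wT act_mult[of "g [^] int N" "g [^] (- int N)" w] act_mult[of "g [^] int N" "g [^] (int N)" w]
        by (simp_all add: ws_def int_pow_mult[OF g, symmetric] del: act_mult)
      then have "dist (ws (- int N)) (ws (int N)) = dist w (ws (int (2 * N)))"
        using act_dist[of "g [^] int N" "ws (- int N)" "ws (int N)"] g wsT by simp
      then show ?thesis unfolding r by simp
    qed
    define p q p' q' where "p = zs (- int N)" and "q = zs (int N)"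
      and "p' = ws (- int N)" and "q' = ws (int N)"
    have T: "p \<in> T" "q \<in> T" "p' \<in> T" "q' \<in> T" by (simp_all add: p_def q_def p'_def q'_def zsT wsT)
    have d: "dist p p' = C" "dist q q' = C" "dist p' w = \<tau> * N" "dist w q' = \<tau> * N"
      "dist p' q' = 2 * \<tau> * N" "dist p q = 2 * \<tau> * N"
      by (simp_all add: p_def q_def p'_def q'_def C l r lr zs_dist)
    \<comment> \<open>Seen from \<open>w\<close>, the points \<open>p\<close> and \<open>p'\<close> lie in one direction and \<open>q\<close>, \<open>q'\<close> in the opposite one.\<close>
    have "dist p w + dist p' q' \<le> max (dist p p' + dist w q') (dist p q' + dist w p')"
      "dist q w + dist p q' \<le> max (dist q p + dist w q') (dist q q' + dist w p)"
      using four_point[of p p' w q'] four_point[of q p w q'] T wT by (simp_all add: dist_commute)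
    then have "dist p w + dist w q \<le> 2 * \<tau> * N"
      using d N zero_le_dist[of p w] zero_le_dist[of q w] dist_commute[of w p] dist_commute[of p q]
        dist_commute[of q w] dist_commute[of w p']
      unfolding le_max_iff_disj mult.commute[of _ \<tau>] by argo
    then have "on N w" using dist_triangle[of p q w] d(6) wT by (simp add: on_def p_def q_def)
    then show ?thesis by blast
  qed
  define f where "f w = co (SOME N. on N w) w" for w
  have f: "f w = co N w" if "on N w" for N w
  proof -
    have "on (SOME N. on N w) w" using that by (rule someI)
    then show ?thesis using mono[of "SOME N. on N w" w N] mono[OF that, of "SOME N. on N w"]
      by (cases "N \<le> (SOME N. on N w)") (auto simp: f_def)
  qed
  have "f ` axis g = UNIV"
  proof (intro equalityI subsetI)
    fix r :: real
    obtain N :: nat where N: "\<bar>r\<bar> < real N * \<tau>" using reals_Archimedean3[OF \<tau>] by blast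
    have d: "dist (zs (- int N)) (zs (int N)) = 2 * \<tau> * N" by (simp add: zs_dist)
    obtain w where "w \<in> T" "dist (zs (- int N)) w = \<tau> * N + r"
      "dist w (zs (int N)) = 2 * \<tau> * N - (\<tau> * N + r)"
    proof -
      have "0 \<le> \<tau> * N + r" "\<tau> * N + r \<le> dist (zs (- int N)) (zs (int N))"
        unfolding d using N by (simp_all add: mult.commute abs_if split: if_splits)
      then show ?thesis using that segment_point[OF zsT zsT] d by metis
    qed
    then have "on N w" "co N w = r" by (simp_all add: on_def co_def)
    then show "r \<in> f ` axis g" using on_axis f by force
  qed simp
  moreover have "dist v w = \<bar>f v - f w\<bar>" if vw: "v \<in> axis g" "w \<in> axis g" for v w
  proof -
    obtain N M where "on N v" "on M w" using vw axis_on by blast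
    then have "on (N + M) v" "on (N + M) w" using mono by auto
    then show ?thesis using co_dist f by simp
  qed
  moreover have "\<phi> g w \<in> axis g \<and> f (\<phi> g w) = f w + \<tau>" if w: "w \<in> axis g" for w
  proof -
    obtain N where "on N w" using w axis_on by blast
    then show ?thesis using step on_axis f by metis
  qed
  ultimately show ?thesis using \<tau> axis_in unfolding line_coord_def shift_def by blast
qed

end

section \<open>Translations of lines, common fixed points and bridges\<close>

context tree_action
begin

lemma line_coord_dist: "line_coord L f \<Longrightarrow> x \<in> L \<Longrightarrow> y \<in> L \<Longrightarrow> dist x y = \<bar>f x - f y\<bar>"
  by (simp add: line_coord_def)

lemma line_coord_in: "line_coord L f \<Longrightarrow> x \<in> L \<Longrightarrow> x \<in> T"
  by (auto simp: line_coord_def)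

lemma line_coord_ex: "line_coord L f \<Longrightarrow> \<exists>x\<in>L. f x = r"
  unfolding line_coord_def by (metis UNIV_I imageE)

lemma line_coord_inj: "line_coord L f \<Longrightarrow> x \<in> L \<Longrightarrow> y \<in> L \<Longrightarrow> f x = f y \<Longrightarrow> x = y"
  using line_coord_dist by fastforce

text \<open>An isometry of the real line that commutes with a nontrivial translation is itself a translation,
  since a reflection reverses the direction of the translation.\<close>

lemma shift_of_commuting:
  assumes gk: "g \<in> carrier G" "k \<in> carrier G" "k \<otimes> g = g \<otimes> k"
    and f: "line_coord L f" and g: "shift L f g \<tau>" "\<tau> \<noteq> 0"
    and k: "\<And>x. x \<in> L \<Longrightarrow> \<phi> k x \<in> L"
  shows "\<exists>\<sigma>. shift L f k \<sigma>"
proof -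
  note T = line_coord_in[OF f]
  have same: "f (\<phi> k x) - f (\<phi> k y) = f x - f y" if xy: "x \<in> L" "y \<in> L" for x y
  proof -
    have gx: "\<phi> g x \<in> L" "f (\<phi> g x) = f x + \<tau>"
      using g xy unfolding shift_def by auto
    have "\<phi> k (\<phi> g x) = \<phi> g (\<phi> k x)"
      using act_commute[OF gk(3)] gk xy by (simp add: T)
    then have "f (\<phi> k (\<phi> g x)) = f (\<phi> k x) + \<tau>"
      using g k[OF xy(1)] unfolding shift_def by auto
    moreover have iso: "\<bar>f (\<phi> k u) - f (\<phi> k y)\<bar> = \<bar>f u - f y\<bar>" if "u \<in> L" for u
      using line_coord_dist[OF f k[OF that] k[OF xy(2)]] line_coord_dist[OF f that xy(2)]
        gk that xy(2) by (simp add: T)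
    ultimately show ?thesis
      using iso[OF xy(1)] iso[OF gx(1)] gx(2) g(2) by argo
  qed
  obtain y where y: "y \<in> L" using line_coord_ex[OF f] by blast
  have "f (\<phi> k x) = f x + (f (\<phi> k y) - f y)" if "x \<in> L" for x
    using same[OF that y] by linarith
  then show ?thesis using k unfolding shift_def by blast
qed

lemma shift_dist:
  assumes "line_coord L f" "shift L f k \<sigma>" "x \<in> L"
  shows "dist x (\<phi> k x) = \<bar>\<sigma>\<bar>" "dist x (\<phi> k (\<phi> k x)) = 2 * \<bar>\<sigma>\<bar>"
  using assms line_coord_dist[OF assms(1)] unfolding shift_def by auto

lemma elliptic_shift:
  assumes "k \<in> carrier G" "line_coord L f" "shift L f k \<sigma>" "elliptic k"
  shows "\<sigma> = 0"
proof -
  obtain x where x: "x \<in> L" using line_coord_ex[OF assms(2)] by blast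
  then show ?thesis
    using shift_dist[OF assms(2,3) x] elliptic_double[OF assms(1,4) line_coord_in[OF assms(2) x]]
    by linarith
qed

lemma shift_one: "line_coord L f \<Longrightarrow> shift L f \<one> 0"
  by (simp add: shift_def line_coord_in)

lemma shift_mult:
  assumes "g \<in> carrier G" "h \<in> carrier G" "line_coord L f" "shift L f g \<sigma>" "shift L f h \<tau>"
  shows "shift L f (g \<otimes> h) (\<sigma> + \<tau>)"
  using assms by (simp add: shift_def line_coord_in)

lemma shift_inv:
  assumes g: "g \<in> carrier G" and f: "line_coord L f" and s: "shift L f g \<sigma>"
  shows "shift L f (inv g) (- \<sigma>)"
  unfolding shift_def
proof
  fix x assume x: "x \<in> L"
  obtain y where y: "y \<in> L" "f y = f x - \<sigma>" using line_coord_ex[OF f] by blast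
  then have "\<phi> g y = x"
    using s x by (intro line_coord_inj[OF f]) (auto simp: shift_def)
  then have "\<phi> (inv g) x = y" using g line_coord_in[OF f y(1)] by auto
  then show "\<phi> (inv g) x \<in> L \<and> f (\<phi> (inv g) x) = f x + - \<sigma>" using y by simp
qed

text \<open>Each of the two isometries translates the axis of the other one, by a nonzero amount because it
  has no fixed point; so each axis is contained in the other.\<close>

lemma axis_eq_of_commute:
  assumes gh: "g \<in> carrier G" "h \<in> carrier G" "g \<otimes> h = h \<otimes> g"
    and hyp: "\<not> elliptic g" "\<not> elliptic h" and ne: "T \<noteq> {}"
  shows "axis g = axis h"
proof -
  have sub: "axis u \<subseteq> axis v"
    if uv: "u \<in> carrier G" "v \<in> carrier G" "u \<otimes> v = v \<otimes> u" "\<not> elliptic u" for u v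
  proof
    fix x assume x: "x \<in> axis u"
    obtain f \<tau> where f: "\<tau> > 0" "line_coord (axis u) f" "shift (axis u) f u \<tau>"
      using axis_line_coord_exists uv ne by blast
    then obtain \<sigma> where "shift (axis u) f v \<sigma>"
      using shift_of_commuting[OF uv(1,2) uv(3)[symmetric] f(2,3)] axis_act_commute uv by force
    then show "x \<in> axis v"
      using shift_dist[OF f(2) _ x] axis_in[OF x] by (simp add: axis_def)
  qed
  show ?thesis using sub[of g h] sub[of h g] gh hyp by auto
qed

lemma elliptic_inv: "g \<in> carrier G \<Longrightarrow> elliptic (inv g) \<longleftrightarrow> elliptic g"
  unfolding elliptic_def by (metis act_inv_act act_act_inv)

lemma hyperbolic_pow:
  assumes g: "g \<in> carrier G" "\<not> elliptic g" and k: "k > 0" and ne: "T \<noteq> {}"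
  shows "\<not> elliptic (g [^] (k::nat))"
proof
  assume ell: "elliptic (g [^] k)"
  obtain f \<tau> where f: "\<tau> > 0" "line_coord (axis g) f" "shift (axis g) f g \<tau>"
    using axis_line_coord_exists g ne by blast
  have "shift (axis g) f (g [^] j) (real j * \<tau>)" for j :: nat
  proof (induction j)
    case 0 then show ?case using shift_one[OF f(2)] by simp
  next
    case (Suc j)
    then show ?case
      using shift_mult[OF _ g(1) f(2) _ f(3)] g by (simp add: algebra_simps(1) distrib_right) (metis add.commute nat_pow_closed)
  qed
  then have "real k * \<tau> = 0" using elliptic_shift[OF _ f(2) _ ell] g by blast
  then show False using f(1) k by simp
qed

text \<open>For a fixed point \<open>v\<close> of \<open>b\<close>, the points \<open>a v\<close> and \<open>a (b v)\<close> coincide, so the midpoint of \<open>v\<close> and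
  \<open>a v\<close> is fixed by both \<open>a\<close> and \<open>a b\<close>.\<close>

lemma common_fixed_point_of_elliptic_product:
  assumes ab: "a \<in> carrier G" "b \<in> carrier G" and "elliptic a" "elliptic b" "elliptic (a \<otimes> b)"
  shows "\<exists>x\<in>T. \<phi> a x = x \<and> \<phi> b x = x"
proof -
  obtain u v w where u: "u \<in> T" "\<phi> a u = u" and v: "v \<in> T" "\<phi> b v = v"
    and w: "w \<in> T" "\<phi> (a \<otimes> b) w = w"
    using assms unfolding elliptic_def by blast
  obtain m where m: "mid m v (\<phi> a v)" using mid_exists v ab by force
  have "\<phi> a m = m" using elliptic_mid[OF ab(1) u v(1) m] by simp
  moreover have "\<phi> (a \<otimes> b) m = m"
    using elliptic_mid(1)[OF _ w v(1)] m v ab by simp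
  ultimately show ?thesis using mid_in[OF m] ab by (metis act_eq_iff act_in act_mult)
qed

text \<open>The fixed points of \<open>b\<close> form a convex set preserved by \<open>a\<close>, which contains the midpoint of
  any of its points \<open>v\<close> and \<open>a v\<close>.\<close>

lemma common_fixed_point_of_commuting:
  assumes ab: "a \<in> carrier G" "b \<in> carrier G" "a \<otimes> b = b \<otimes> a" and "elliptic a" "elliptic b"
  shows "\<exists>x\<in>T. \<phi> a x = x \<and> \<phi> b x = x"
proof -
  obtain u v where u: "u \<in> T" "\<phi> a u = u" and v: "v \<in> T" "\<phi> b v = v"
    using assms unfolding elliptic_def by blast
  obtain m where m: "mid m v (\<phi> a v)" using mid_exists v ab by force
  have a: "\<phi> a m = m" using elliptic_mid[OF ab(1) u v(1) m] by simp
  have "\<phi> b (\<phi> a v) = \<phi> a v" using act_commute[OF ab(3)] ab v by metis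
  then have "\<phi> b m = m"
    using fixed_between[OF ab(2), of v "\<phi> a v" m] m v ab by (simp add: mid_def)
  then show ?thesis using a mid_in[OF m] by blast
qed

lemma common_fixed_point_of_pairs:
  assumes c: "a \<in> carrier G" "b \<in> carrier G" "c \<in> carrier G"
    and "\<exists>x\<in>T. \<phi> a x = x \<and> \<phi> b x = x" "\<exists>x\<in>T. \<phi> b x = x \<and> \<phi> c x = x"
      "\<exists>x\<in>T. \<phi> a x = x \<and> \<phi> c x = x"
  shows "\<exists>x\<in>T. \<phi> a x = x \<and> \<phi> b x = x \<and> \<phi> c x = x"
proof -
  obtain x y z where x: "x \<in> T" "\<phi> a x = x" "\<phi> b x = x" and y: "y \<in> T" "\<phi> b y = y" "\<phi> c y = y"
    and z: "z \<in> T" "\<phi> a z = z" "\<phi> c z = z"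
    using assms by blast
  obtain m where m: "m \<in> T" "dist x m + dist m y = dist x y" "dist y m + dist m z = dist y z"
    "dist x m + dist m z = dist x z"
    using median x y z by blast
  have "\<phi> a m = m" using fixed_between[OF c(1), of x z m] x z m by blast
  moreover have "\<phi> b m = m" using fixed_between[OF c(2), of x y m] x y m by blast
  moreover have "\<phi> c m = m" using fixed_between[OF c(3), of y z m] y z m by blast
  ultimately show ?thesis using m by blast
qed

text \<open>Projecting an arbitrary fixed point of \<open>h\<close> to the fixed points of \<open>g\<close>, and the result back to
  those of \<open>h\<close>, gives the ends of the shortest path between the two sets. That \<open>p\<close> and \<open>q\<close> are
  projections of each other is expressed through midpoints as in \<open>elliptic_mid\<close>.\<close>

lemma bridge:
  assumes gh: "g \<in> carrier G" "h \<in> carrier G" and "elliptic g" "elliptic h"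
  shows "\<exists>p q. \<phi> h p = p \<and> \<phi> g q = q \<and> mid q p (\<phi> g p) \<and> mid p q (\<phi> h q)"
proof -
  obtain u v where u: "u \<in> T" "\<phi> g u = u" and v: "v \<in> T" "\<phi> h v = v"
    using assms unfolding elliptic_def by blast
  obtain q where q: "mid q v (\<phi> g v)" using mid_exists v gh by force
  have qT: "q \<in> T" using mid_in[OF q] .
  have gq: "\<phi> g q = q" using elliptic_mid[OF gh(1) u v(1) q] by simp
  obtain p where p: "mid p q (\<phi> h q)" using mid_exists qT gh by force
  have pT: "p \<in> T" using mid_in[OF p] .
  have hp: "\<phi> h p = p" and vp: "dist v q = dist v p + dist p q"
    using elliptic_mid[OF gh(2) v qT p] by auto
  have "dist (\<phi> g v) q = dist v q" "dist (\<phi> g p) q = dist p q" "dist (\<phi> g v) (\<phi> g p) = dist v p"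
    using act_dist[of g v q] act_dist[of g p q] gq gh v qT pT by auto
  moreover have "dist v (\<phi> g v) = 2 * dist v q" using q by (simp add: mid_def)
  ultimately have "mid q p (\<phi> g p)"
    using vp dist_triangle[of v "\<phi> g v" p] dist_triangle[of p "\<phi> g v" "\<phi> g p"]
      dist_triangle[of p "\<phi> g p" q] dist_commute[of "\<phi> g p" q] dist_commute[of "\<phi> g p" "\<phi> g v"] qT
    by (auto simp: mid_def)
  then show ?thesis using hp gq p by blast
qed

end

section \<open>Dihedral Artin groups of odd type\<close>

context group
begin

lemma pow_mult_swap:
  assumes "u \<in> carrier G" "v \<in> carrier G"
  shows "(u \<otimes> v) [^] (k::nat) \<otimes> u = u \<otimes> (v \<otimes> u) [^] k"
proof (induction k)
  case 0 then show ?case using assms by simp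
next
  case (Suc k)
  have "(u \<otimes> v) [^] Suc k \<otimes> u = (u \<otimes> v) [^] k \<otimes> u \<otimes> (v \<otimes> u)"
    using assms by (simp add: m_assoc)
  then show ?case unfolding Suc using assms by (simp add: m_assoc)
qed

end

text \<open>The generators \<open>a\<close>, \<open>b\<close> satisfy the braid relation of length \<open>2 k + 1\<close>; the element \<open>\<Delta>\<close> defined
  below is the image of the Garside element of the dihedral Artin group.\<close>

locale odd_dihedral = group G for G (structure) +
  fixes a b :: 'a and k :: nat
  assumes a [simp]: "a \<in> carrier G" and b [simp]: "b \<in> carrier G"
    and braid: "(a \<otimes> b) [^] k \<otimes> a = b \<otimes> (a \<otimes> b) [^] k"
begin

definition \<Delta> where "\<Delta> = (a \<otimes> b) [^] k \<otimes> a"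

lemma Delta [simp]: "\<Delta> \<in> carrier G"
  by (simp add: \<Delta>_def)

lemma Delta_eq: "\<Delta> = b \<otimes> (a \<otimes> b) [^] k"
  by (simp add: \<Delta>_def braid)

lemma Delta_b: "\<Delta> \<otimes> b = (a \<otimes> b) [^] (Suc k)"
  by (simp add: \<Delta>_def m_assoc)

lemma Delta_a: "\<Delta> \<otimes> a = b \<otimes> \<Delta>"
  by (simp add: \<Delta>_def braid m_assoc)

lemma a_Delta: "a \<otimes> \<Delta> = (a \<otimes> b) [^] (Suc k)"
  unfolding Delta_eq using nat_pow_Suc2[of "a \<otimes> b" k] by (simp add: m_assoc)

lemma Delta_square: "\<Delta> \<otimes> \<Delta> = (a \<otimes> b) [^] (2 * k + 1)"
proof -
  have "\<Delta> \<otimes> \<Delta> = (a \<otimes> b) [^] k \<otimes> (a \<otimes> \<Delta>)" by (simp add: \<Delta>_def m_assoc)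
  also have "\<dots> = (a \<otimes> b) [^] (k + Suc k)" unfolding a_Delta by (rule nat_pow_mult) simp
  finally show ?thesis by (simp add: mult_2)
qed

lemma Delta_square_commute:
  "\<Delta> \<otimes> \<Delta> \<otimes> a = a \<otimes> (\<Delta> \<otimes> \<Delta>)" "\<Delta> \<otimes> \<Delta> \<otimes> b = b \<otimes> (\<Delta> \<otimes> \<Delta>)"
proof -
  have s: "\<Delta> \<otimes> b = a \<otimes> \<Delta>" by (simp only: Delta_b a_Delta)
  show "\<Delta> \<otimes> \<Delta> \<otimes> a = a \<otimes> (\<Delta> \<otimes> \<Delta>)"
    using Delta_a s a b Delta by (metis m_assoc)
  show "\<Delta> \<otimes> \<Delta> \<otimes> b = b \<otimes> (\<Delta> \<otimes> \<Delta>)"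
    using Delta_a s a b Delta by (metis m_assoc)
qed

end

section \<open>Dihedral Artin groups acting on trees\<close>

context tree_action
begin

lemma dihedral_elliptic_iff:
  assumes "odd_dihedral G a b k"
  shows "elliptic b \<longleftrightarrow> elliptic a"
proof -
  interpret odd_dihedral G a b k by fact
  have eq: "\<phi> \<Delta> (\<phi> a x) = \<phi> b (\<phi> \<Delta> x)" if "x \<in> T" for x
    using Delta_a that a b Delta by (metis act_mult)
  show ?thesis
  proof
    assume "elliptic a"
    then obtain x where "x \<in> T" "\<phi> a x = x" by (auto simp: elliptic_def)
    then show "elliptic b" using eq[of x] unfolding elliptic_def by (metis Delta act_in)
  next
    assume "elliptic b"
    then obtain x where x: "x \<in> T" "\<phi> b x = x" by (auto simp: elliptic_def)
    then have "\<phi> \<Delta> (\<phi> a (\<phi> (inv \<Delta>) x)) = \<phi> \<Delta> (\<phi> (inv \<Delta>) x)" using eq[of "\<phi> (inv \<Delta>) x"] by simp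
    then show "elliptic a" using x(1) unfolding elliptic_def
      by (metis Delta a act_eq_iff act_in inv_closed)
  qed
qed

text \<open>If \<open>a b\<close> were hyperbolic, so would be its power \<open>\<Delta> \<Delta>\<close>. The generators commute with
  \<open>\<Delta> \<Delta>\<close>, hence translate its axis; being elliptic they fix it pointwise, and so does \<open>a b\<close>.\<close>

lemma dihedral_product_elliptic:
  assumes "odd_dihedral G a b k" and ell: "elliptic a"
  shows "elliptic (a \<otimes> b)"
proof (rule ccontr)
  assume hyp: "\<not> elliptic (a \<otimes> b)"
  interpret odd_dihedral G a b k by fact
  have ne: "T \<noteq> {}" using ell by (auto simp: elliptic_def)
  define h where "h = \<Delta> \<otimes> \<Delta>"
  have hG: "h \<in> carrier G" by (simp add: h_def)
  have "\<not> elliptic h"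
    using hyperbolic_pow[OF _ hyp _ ne, of "2 * k + 1"] unfolding h_def Delta_square by simp
  then obtain f \<tau> where f: "\<tau> > 0" "line_coord (axis h) f" "shift (axis h) f h \<tau>"
    using axis_line_coord_exists hG ne by blast
  have zero: "shift (axis h) f g 0" if g: "g \<in> carrier G" "h \<otimes> g = g \<otimes> h" "elliptic g" for g
  proof -
    obtain \<sigma> where \<sigma>: "shift (axis h) f g \<sigma>"
      using shift_of_commuting[OF hG g(1) g(2)[symmetric] f(2,3)] f(1)
        axis_act_commute[OF hG g(1) g(2)[symmetric]] by auto
    then show ?thesis using elliptic_shift[OF g(1) f(2) _ g(3)] by blast
  qed
  have "shift (axis h) f (a \<otimes> b) (0 + 0)"
    using zero[of a] zero[of b] ell dihedral_elliptic_iff[OF assms(1)] Delta_square_commute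
    by (intro shift_mult f) (simp_all add: h_def)
  moreover obtain x where x: "x \<in> axis h" using line_coord_ex[OF f(2)] by blast
  ultimately have "dist x (\<phi> (a \<otimes> b) x) = 0"
    using shift_dist(1)[OF f(2), of "a \<otimes> b" 0 x] by simp
  then show False using hyp axis_in[OF x] unfolding elliptic_def by (metis dist_eq_0_iff)
qed

lemma dihedral_common_fixed_point:
  assumes "odd_dihedral G a b k" and "elliptic a"
  shows "\<exists>x\<in>T. \<phi> a x = x \<and> \<phi> b x = x"
  using common_fixed_point_of_elliptic_product[OF odd_dihedral.a[OF assms(1)] odd_dihedral.b[OF assms(1)]]
    dihedral_elliptic_iff[OF assms(1)] dihedral_product_elliptic[OF assms] assms(2) by simp

text \<open>Three convex sets that meet pairwise have a common point.\<close>

lemma global_fixed_point: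
  assumes ab: "odd_dihedral G a b m" and cb: "odd_dihedral G c b n"
    and ac: "a \<otimes> c = c \<otimes> a" and ell: "elliptic a"
  shows "\<exists>x\<in>T. \<phi> a x = x \<and> \<phi> b x = x \<and> \<phi> c x = x"
proof -
  have G: "a \<in> carrier G" "b \<in> carrier G" "c \<in> carrier G"
    using odd_dihedral.a[OF ab] odd_dihedral.b[OF ab] odd_dihedral.a[OF cb] by auto
  have "elliptic c" using dihedral_elliptic_iff[OF ab] dihedral_elliptic_iff[OF cb] ell by blast
  then show ?thesis
    using common_fixed_point_of_pairs[OF G dihedral_common_fixed_point[OF ab ell]]
      dihedral_common_fixed_point[OF cb] common_fixed_point_of_commuting[OF G(1,3) ac ell] by metis
qed

text \<open>The line is the axis of the central element \<open>\<Delta> \<Delta>\<close>. It is also the axis of \<open>a\<close>, which is why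
  \<open>c\<close>, commuting with \<open>a\<close> only, preserves it.\<close>

lemma dihedral_line:
  assumes ab: "odd_dihedral G a b m" and c: "c \<in> carrier G" "a \<otimes> c = c \<otimes> a"
    and hyp: "\<not> elliptic a" "\<not> elliptic (a \<otimes> b)" and ne: "T \<noteq> {}"
  shows "\<exists>L f \<alpha> \<beta> \<gamma>. line_coord L f \<and> shift L f a \<alpha> \<and> shift L f b \<beta> \<and> shift L f c \<gamma>"
proof -
  interpret odd_dihedral G a b m by fact
  define h where "h = \<Delta> \<otimes> \<Delta>"
  have hG: "h \<in> carrier G" by (simp add: h_def)
  have h: "\<not> elliptic h"
    using hyperbolic_pow[OF _ hyp(2) _ ne, of "2 * m + 1"] unfolding h_def Delta_square by simp
  then obtain f \<tau> where f: "\<tau> > 0" "line_coord (axis h) f" "shift (axis h) f h \<tau>"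
    using axis_line_coord_exists hG ne by blast
  have s: "\<exists>\<sigma>. shift (axis h) f g \<sigma>" if g: "g \<in> carrier G" "h \<otimes> g = g \<otimes> h" for g
    using shift_of_commuting[OF hG g(1) g(2)[symmetric] f(2,3)] f(1)
        axis_act_commute[OF hG g(1) g(2)[symmetric]] by auto
  obtain \<alpha> \<beta> where \<alpha>\<beta>: "shift (axis h) f a \<alpha>" "shift (axis h) f b \<beta>"
    using s[of a] s[of b] Delta_square_commute by (auto simp: h_def)
  have eq: "axis a = axis h"
    using axis_eq_of_commute[of a h] Delta_square_commute hG h hyp ne by (simp add: h_def)
  have "\<alpha> \<noteq> 0"
  proof
    assume "\<alpha> = 0"
    obtain x where x: "x \<in> axis h" using line_coord_ex[OF f(2)] by blast
    have "dist x (\<phi> a x) = 0" using shift_dist(1)[OF f(2) \<alpha>\<beta>(1) x] \<open>\<alpha> = 0\<close> by simp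
    then show False using hyp axis_in[OF x] unfolding elliptic_def by (metis dist_eq_0_iff)
  qed
  then obtain \<gamma> where "shift (axis h) f c \<gamma>"
    using shift_of_commuting[OF a c(1) c(2)[symmetric] f(2) \<alpha>\<beta>(1)]
      axis_act_commute[OF a c(1) c(2)[symmetric]] unfolding eq by blast
  then show ?thesis using f(2) \<alpha>\<beta> by blast
qed

text \<open>The path from \<open>p\<close> to \<open>q\<close> is the bridge between the fixed points of \<open>\<Delta>\<close> and those of \<open>a b\<close>. The
  midpoint conditions record its position: \<open>q\<close> is halfway from \<open>p\<close> to \<open>a p\<close>, so \<open>a\<close> translates from \<open>p\<close>
  towards \<open>q\<close>, and \<open>b\<close> does so from \<open>q\<close> towards \<open>p\<close>. The last clause says that the tree branches at
  \<open>q\<close>: three points lie in pairwise different directions from it.\<close>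

definition dihedral_bridge :: "'g \<Rightarrow> 'g \<Rightarrow> nat \<Rightarrow> 'a \<Rightarrow> 'a \<Rightarrow> bool" where
  "dihedral_bridge a b k p q \<longleftrightarrow>
    p \<in> axis a \<inter> axis b \<and> q \<in> axis a \<inter> axis b \<and> p \<noteq> q \<and>
    \<phi> ((a \<otimes> b) [^] k \<otimes> a) p = p \<and> \<phi> (a \<otimes> b) q = q \<and>
    mid q p (\<phi> a p) \<and> mid p q (\<phi> b q) \<and>
    mid p q (\<phi> ((a \<otimes> b) [^] k \<otimes> a) q) \<and>
    (\<exists>r\<in>T. \<exists>s\<in>T. mid q p r \<and> mid q r s \<and> mid q p s)"

lemma axis_inv:
  assumes "g \<in> carrier G" "\<not> elliptic g" "T \<noteq> {}"
  shows "axis (inv g) = axis g"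
  using axis_eq_of_commute[of "inv g" g] elliptic_inv[of g] assms by simp

text \<open>The path is a bridge between the fixed points of \<open>\<Delta>\<close> and those of \<open>y = x^k\<close>. The power \<open>y\<close>, rather
  than \<open>x\<close> itself, is what links \<open>\<Delta>\<close> to the generators: \<open>\<Delta> = y a\<close> and \<open>\<Delta> b = x y\<close>.\<close>

lemma dihedral_bridge_exists:
  assumes ab: "odd_dihedral G a b k" and hyp: "\<not> elliptic a" and ell: "elliptic (a \<otimes> b)"
  shows "\<exists>p q. dihedral_bridge a b k p q"
proof -
  interpret odd_dihedral G a b k by fact
  define x y where "x = a \<otimes> b" and "y = x [^] k"
  have xy: "x \<in> carrier G" "y \<in> carrier G" by (simp_all add: x_def y_def)
  have ne: "T \<noteq> {}" using ell by (auto simp: elliptic_def)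
  have hypb: "\<not> elliptic b" using dihedral_elliptic_iff[OF ab] hyp by blast
  have ell_pow: "elliptic (x [^] j)" for j :: nat
    using ell fixed_pow[OF xy(1)] by (auto simp: x_def elliptic_def)
  have "elliptic (\<Delta> \<otimes> \<Delta>)" using ell_pow unfolding Delta_square x_def .
  then have "elliptic \<Delta>" by (rule elliptic_of_square[OF Delta])
  then obtain p q where p: "\<phi> \<Delta> p = p" and q: "\<phi> y q = q" and qm: "mid q p (\<phi> y p)"
    and pm: "mid p q (\<phi> \<Delta> q)"
    using bridge[OF xy(2) Delta] ell_pow by (auto simp: y_def)
  have T: "p \<in> T" "q \<in> T" using qm pm by (auto simp: mid_def)
  have \<Delta>_act: "\<phi> \<Delta> u = \<phi> y (\<phi> a u)" if "u \<in> T" for u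
    using that xy by (simp add: \<Delta>_def x_def y_def)
  have ne_pq: "p \<noteq> q"
  proof
    assume "p = q"
    then have "\<phi> y (\<phi> a p) = \<phi> y p" using \<Delta>_act[OF T(1)] p q by simp
    then show False using hyp T xy unfolding elliptic_def by (metis a act_eq_iff act_in)
  qed
  \<comment> \<open>\<open>x^(2k+1) = \<Delta> \<Delta>\<close> fixes \<open>p\<close>, commutes with \<open>y\<close>, and hence fixes the midpoint \<open>q\<close> of
    \<open>p\<close> and \<open>y p\<close>; as \<open>y\<close> fixes \<open>q\<close>, so does \<open>x\<close>.\<close>
  define h where "h = x [^] (2 * k + 1)"
  have h: "h = \<Delta> \<otimes> \<Delta>" "h \<in> carrier G" using Delta_square xy by (simp_all add: h_def x_def)
  have hp: "\<phi> h p = p" using h(1) p T by simp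
  have "h \<otimes> y = y \<otimes> h" unfolding h_def y_def nat_pow_mult[OF xy(1)] by (simp add: add.commute)
  then have "\<phi> h (\<phi> y p) = \<phi> y p" using act_commute[of h y p] h(2) xy T hp by simp
  then have "\<phi> h q = q"
    using fixed_between[OF h(2), of p "\<phi> y p" q] hp qm T xy by (simp add: mid_def)
  moreover have hx: "h = x \<otimes> (y \<otimes> y)"
    unfolding h_def y_def nat_pow_mult[OF xy(1)] nat_pow_Suc2[OF xy(1), symmetric] by (simp add: mult_2)
  ultimately have xq: "\<phi> x q = q" using q xy T by simp
  have xyy: "\<phi> x (\<phi> y (\<phi> y p)) = p" using hp T xy unfolding hx by simp
  have yap: "\<phi> y (\<phi> a p) = p" using \<Delta>_act T p by simp
  \<comment> \<open>The two generators move \<open>p\<close> and \<open>q\<close> along paths through the midpoints \<open>q\<close> and \<open>p\<close>.\<close>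
  have qa: "mid q p (\<phi> a p)"
  proof -
    have "mid (\<phi> y q) (\<phi> y p) (\<phi> y (\<phi> a p))" using qm q yap by (simp add: mid_commute)
    then show ?thesis using xy T by (simp del: act_mult)
  qed
  have \<Delta>b: "\<Delta> \<otimes> b = x \<otimes> y"
    unfolding Delta_b x_def[symmetric] y_def by (rule nat_pow_Suc2[OF xy(1)])
  have pb: "mid p q (\<phi> b q)"
  proof -
    have "\<phi> \<Delta> (\<phi> b q) = q" using \<Delta>b q xq xy T by (metis Delta act_mult b)
    then have "mid (\<phi> \<Delta> p) (\<phi> \<Delta> q) (\<phi> \<Delta> (\<phi> b q))" using pm p by (simp add: mid_commute)
    then show ?thesis using T by (simp del: act_mult)
  qed
  have pa: "mid p q (\<phi> (inv a) q)"
  proof -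
    have "\<phi> \<Delta> (\<phi> (inv a) q) = q" using \<Delta>_act[of "\<phi> (inv a) q"] q T by simp
    then have "mid (\<phi> \<Delta> p) (\<phi> \<Delta> q) (\<phi> \<Delta> (\<phi> (inv a) q))" using pm p by (simp add: mid_commute)
    then show ?thesis using T by (simp del: act_mult)
  qed
  have qb: "mid q p (\<phi> (inv b) p)"
  proof -
    have "\<phi> x (\<phi> y (\<phi> (inv b) p)) = p" using \<Delta>b p xy T
      by (metis Delta act_act_inv act_in act_mult b inv_closed)
    then have "\<phi> y (\<phi> (inv b) p) = \<phi> y (\<phi> y p)"
      using xyy xy T by (metis act_eq_iff act_in b inv_closed)
    then have "\<phi> (inv b) p = \<phi> y p" using xy T by (simp del: act_mult)
    then show ?thesis using qm by simp
  qed
  have axes: "p \<in> axis a" "p \<in> axis b" "q \<in> axis a" "q \<in> axis b"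
    using mid_in_axis[OF _ _ T(1) qa] mid_in_axis[OF _ _ T(2) pb] mid_in_axis[OF _ _ T(2) pa]
      mid_in_axis[OF _ _ T(1) qb] axis_inv[OF _ _ ne] elliptic_inv hyp hypb by auto
  \<comment> \<open>\<open>p\<close>, \<open>y p\<close> and \<open>y y p = x^(-1) p\<close> lie in three different directions from \<open>q\<close>.\<close>
  have "\<exists>r\<in>T. \<exists>s\<in>T. mid q p r \<and> mid q r s \<and> mid q p s"
  proof (intro bexI conjI)
    show "mid q p (\<phi> y p)" by fact
    show "mid q (\<phi> y p) (\<phi> y (\<phi> y p))" using mid_act[OF xy(2) T(2,1), of "\<phi> y p"] qm q xy T by simp
    have inv_xp: "\<phi> (inv x) p = \<phi> y (\<phi> y p)" using xyy xy T by (metis act_in act_inv_act)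
    obtain r where r: "mid r p (\<phi> (inv x) p)" using mid_exists T xy by force
    have rT: "r \<in> T" using mid_in[OF r] .
    have r1: "\<phi> (inv x) r = r" "dist q p = dist q r + dist r p"
      using elliptic_mid[OF _ T(2) fixed_inv[OF xy(1) T(2) xq] T(1) r] xy by auto
    have "\<phi> x r = r" using fixed_inv[OF _ rT r1(1)] xy by simp
    then have "\<phi> y r = r" using fixed_pow[OF xy(1) rT] by (simp add: y_def)
    then have "dist r p = dist r q + dist q p" using elliptic_mid(2)[OF xy(2) rT _ T(1) qm] by blast
    then have "r = q" using r1(2) by (simp add: dist_commute)
    then show "mid q p (\<phi> y (\<phi> y p))" using r inv_xp by simp
  qed (use xy T in auto)
  then show ?thesis
    using axes ne_pq p xq qa pb pm unfolding dihedral_bridge_def \<Delta>_def x_def by auto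
qed

text \<open>In coordinates along the axes, the bridge is half a translation length long; it points in the
  direction of \<open>a\<close> and against that of \<open>b\<close>.\<close>

lemma dihedral_bridge_coord:
  assumes "dihedral_bridge a b k p q"
  shows "line_coord (axis a) f \<Longrightarrow> shift (axis a) f a \<alpha> \<Longrightarrow> f q = f p + \<alpha> / 2"
    and "line_coord (axis b) f \<Longrightarrow> shift (axis b) f b \<beta> \<Longrightarrow> f p = f q + \<beta> / 2"
    and "dist p (\<phi> a p) = 2 * dist p q" "dist q (\<phi> b q) = 2 * dist p q"
proof -
  have mids: "mid q p (\<phi> a p)" "mid p q (\<phi> b q)" using assms by (simp_all add: dihedral_bridge_def)
  then show "dist p (\<phi> a p) = 2 * dist p q" "dist q (\<phi> b q) = 2 * dist p q"
    by (simp_all add: mid_def dist_commute)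
  have T: "p \<in> axis a" "p \<in> axis b" "q \<in> axis a" "q \<in> axis b"
    using assms by (simp_all add: dihedral_bridge_def)
  have half: "f v = f u + \<sigma> / 2" if f: "line_coord (axis g) f" and s: "shift (axis g) f g \<sigma>"
      and uv: "u \<in> axis g" "v \<in> axis g" and m: "mid v u (\<phi> g u)" for f g \<sigma> u v
  proof -
    have "\<phi> g u \<in> axis g" "f (\<phi> g u) = f u + \<sigma>" using s uv by (auto simp: shift_def)
    then show ?thesis
      using line_coord_dist[OF f, of u v] line_coord_dist[OF f, of v "\<phi> g u"]
        line_coord_dist[OF f, of u "\<phi> g u"] uv m unfolding mid_def by argo
  qed
  show "line_coord (axis a) f \<Longrightarrow> shift (axis a) f a \<alpha> \<Longrightarrow> f q = f p + \<alpha> / 2"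
    using half[of a f \<alpha> p q] T mids by blast
  show "line_coord (axis b) f \<Longrightarrow> shift (axis b) f b \<beta> \<Longrightarrow> f p = f q + \<beta> / 2"
    using half[of b f \<beta> q p] T mids by blast
qed

text \<open>On the axis of \<open>b\<close> both bridges point in the same direction. If \<open>c\<close> translated the common axis of
  \<open>a\<close> and \<open>c\<close> against \<open>a\<close>, the bridges would point in opposite directions there; the distances between
  the ends of one bridge and those of the other cannot satisfy both.\<close>

lemma dihedral_bridges_agree:
  assumes ab: "odd_dihedral G a b m" and cb: "odd_dihedral G c b n" and ac: "a \<otimes> c = c \<otimes> a"
    and hyp: "\<not> elliptic a"
    and pq: "dihedral_bridge a b m p q" and rs: "dihedral_bridge c b n r s"
  shows "r = p" "s = q" "\<And>z. z \<in> axis a \<Longrightarrow> \<phi> c z = \<phi> a z"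
proof -
  have G: "a \<in> carrier G" "b \<in> carrier G" "c \<in> carrier G"
    using odd_dihedral.a[OF ab] odd_dihedral.b[OF ab] odd_dihedral.a[OF cb] by auto
  have hyps: "\<not> elliptic b" "\<not> elliptic c"
    using dihedral_elliptic_iff[OF ab] dihedral_elliptic_iff[OF cb] hyp by blast+
  have ax: "p \<in> axis a" "p \<in> axis b" "q \<in> axis a" "q \<in> axis b" "p \<noteq> q"
    "r \<in> axis c" "r \<in> axis b" "s \<in> axis c" "s \<in> axis b" "r \<noteq> s"
    using pq rs by (auto simp: dihedral_bridge_def)
  have ne: "T \<noteq> {}" using axis_in[OF ax(1)] by blast
  have eq: "axis c = axis a"
    using axis_eq_of_commute[OF G(1,3) ac hyp hyps(2) ne] by simp
  obtain f \<alpha> where f: "\<alpha> > 0" "line_coord (axis a) f" "shift (axis a) f a \<alpha>"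
    using axis_line_coord_exists[OF G(1) hyp ne] by blast
  obtain g \<beta> where g: "\<beta> > 0" "line_coord (axis b) g" "shift (axis b) g b \<beta>"
    using axis_line_coord_exists[OF G(2) hyps(1) ne] by blast
  obtain \<gamma> where c: "shift (axis a) f c \<gamma>"
    using shift_of_commuting[OF G(1,3) ac[symmetric] f(2,3)] axis_act_commute[OF G(1,3) ac[symmetric]] f(1)
    by auto
  note P = dihedral_bridge_coord[OF pq] and R = dihedral_bridge_coord[OF rs]
  have fpq: "f q = f p + \<alpha> / 2" and frs: "f s = f r + \<gamma> / 2"
    using P(1)[OF f(2,3)] R(1)[of f \<gamma>] f(2) c by (simp_all add: eq)
  have gpq: "g p = g q + \<beta> / 2" and grs: "g r = g s + \<beta> / 2"
    using P(2)[OF g(2,3)] R(2)[OF g(2,3)] by simp_all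
  have d: "\<bar>f u - f v\<bar> = \<bar>g u - g v\<bar>" if "u \<in> {p, q}" "v \<in> {r, s}" for u v
    using line_coord_dist[OF f(2), of u v] line_coord_dist[OF g(2), of u v] that ax by (auto simp: eq)
  have len: "\<bar>f p - f q\<bar> = \<bar>g p - g q\<bar>" "\<bar>f r - f s\<bar> = \<bar>g r - g s\<bar>"
    using line_coord_dist[OF f(2), of p q] line_coord_dist[OF g(2), of p q]
      line_coord_dist[OF f(2), of r s] line_coord_dist[OF g(2), of r s] ax by (auto simp: eq)
  \<comment> \<open>All translation lengths are twice the length of a bridge.\<close>
  have "\<alpha> = \<beta>" "\<bar>\<gamma>\<bar> = \<beta>" using len fpq frs gpq grs f(1) g(1) by auto
  moreover have "\<gamma> \<noteq> - \<alpha>"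
    using d[of p r] d[of p s] d[of q r] d[of q s] fpq frs gpq grs f(1) \<open>\<alpha> = \<beta>\<close> by auto
  ultimately have \<gamma>: "\<gamma> = \<alpha>" using g(1) by auto
  show agree: "\<phi> c z = \<phi> a z" if "z \<in> axis a" for z
    using line_coord_inj[OF f(2)] c f(3) that unfolding \<gamma> shift_def by simp
  \<comment> \<open>As \<open>a\<close> and \<open>c\<close> agree on their axis and \<open>a b\<close> fixes \<open>q\<close>, so does \<open>c b\<close>.\<close>
  have "\<phi> b q \<in> axis a"
  proof -
    have "\<phi> a (\<phi> b q) = q" using pq G axis_in[OF ax(3)] by (simp add: dihedral_bridge_def)
    then have "\<phi> b q = \<phi> (inv a) q" using G axis_in[OF ax(3)] by (metis act_in act_inv_act)
    then show ?thesis using shift_inv[OF G(1) f(2,3)] ax(3) by (simp add: shift_def)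
  qed
  then have cbq: "\<phi> (c \<otimes> b) q = q"
    using agree pq G axis_in[OF ax(3)] by (simp add: dihedral_bridge_def)
  \<comment> \<open>\<open>c r\<close> is the image of \<open>r\<close> under \<open>(c b)^(-n)\<close>, which fixes \<open>q\<close>; so \<open>q\<close> is halfway from \<open>r\<close> to
    \<open>c r\<close>, just as \<open>s\<close> is.\<close>
  have "dist q (\<phi> c r) = dist q r"
  proof -
    have y: "(c \<otimes> b) [^] n \<in> carrier G" "\<phi> ((c \<otimes> b) [^] n) q = q"
      using fixed_pow[OF _ axis_in[OF ax(3)] cbq] G by auto
    have "\<phi> ((c \<otimes> b) [^] n) (\<phi> c r) = r"
      using rs G y(1) axis_in[OF ax(6)] by (simp add: dihedral_bridge_def)
    then show ?thesis
      using act_dist[OF y(1), of q "\<phi> c r"] y(2) G axis_in[OF ax(3)] axis_in[OF ax(6)] by simp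
  qed
  moreover have "\<phi> c r \<in> axis a" "f (\<phi> c r) = f r + \<alpha>"
    using c ax(6) by (auto simp: shift_def eq \<gamma>)
  ultimately have "f q = f r + \<alpha> / 2"
    using line_coord_dist[OF f(2), of q r] line_coord_dist[OF f(2), of q "\<phi> c r"] ax f(1)
    by (auto simp: eq abs_if split: if_splits)
  then show "s = q" "r = p"
    using line_coord_inj[OF f(2), of s q] line_coord_inj[OF f(2), of r p] fpq frs ax
    by (auto simp: eq \<gamma>)
qed

end

section \<open>Vertices of a simplicial tree\<close>

lemma
  assumes "simplicial_tree T V"
  shows simplicial_tree_real_tree: "real_tree T"
    and simplicial_tree_vertices: "V \<subseteq> T"
    and simplicial_tree_vertex_separation: "\<lbrakk>u \<in> V; v \<in> V; u \<noteq> v\<rbrakk> \<Longrightarrow> 1 \<le> dist u v"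
    and simplicial_tree_edge_cover: "\<lbrakk>x \<in> T; x \<notin> V\<rbrakk> \<Longrightarrow> \<exists>E. is_edge T V E \<and> x \<in> E"
    and simplicial_tree_open_edge: "is_edge T V E \<Longrightarrow> openin (top_of_set T) (E - V)"
proof -
  have *: "real_tree T \<and> V \<subseteq> T \<and> (\<forall>u\<in>V. \<forall>v\<in>V. u \<noteq> v \<longrightarrow> 1 \<le> dist u v) \<and>
    T \<subseteq> V \<union> \<Union>{E. is_edge T V E} \<and>
    (\<forall>E. is_edge T V E \<longrightarrow> openin (top_of_set T) (E - V))"
    using assms unfolding simplicial_tree_def by (elim conjE) (intro conjI, assumption+, rule equalityD1)
  show "real_tree T" using * by (elim conjE)
  show "V \<subseteq> T" using * by (elim conjE)
  show "\<lbrakk>u \<in> V; v \<in> V; u \<noteq> v\<rbrakk> \<Longrightarrow> 1 \<le> dist u v" using * by (elim conjE) simp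
  show "is_edge T V E \<Longrightarrow> openin (top_of_set T) (E - V)" using * by (elim conjE) simp
  have "T \<subseteq> V \<union> \<Union>{E. is_edge T V E}" using * by (elim conjE)
  then show "\<lbrakk>x \<in> T; x \<notin> V\<rbrakk> \<Longrightarrow> \<exists>E. is_edge T V E \<and> x \<in> E" by auto
qed

lemma simplicial_tree_metric_tree: "simplicial_tree T V \<Longrightarrow> metric_tree T"
  by (rule real_tree_metric_tree[OF simplicial_tree_real_tree])

lemma geodesic_segment_compact_connected:
  assumes "geodesic_segment T x y S"
  shows "compact S" "connected S"
proof -
  obtain g where g: "S = g ` {0..dist x y}"
    "\<And>s t. s \<in> {0..dist x y} \<Longrightarrow> t \<in> {0..dist x y} \<Longrightarrow> dist (g s) (g t) = \<bar>s - t\<bar>"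
    using assms unfolding geodesic_segment_def by blast
  have "continuous_on {0..dist x y} g"
    unfolding continuous_on_iff using g(2) by (auto simp: dist_real_def)
  then show "compact S" "connected S"
    unfolding g(1) by (auto intro: compact_continuous_image connected_continuous_image)
qed

lemma edge_vertices:
  assumes T: "simplicial_tree T V" and uv: "u \<in> V" "v \<in> V" "dist u v = 1"
    and x: "x \<in> V" "dist u x + dist x v = 1"
  shows "x = u \<or> x = v"
proof (rule ccontr)
  assume "\<not> ?thesis"
  then have "1 \<le> dist u x" "1 \<le> dist x v"
    using simplicial_tree_vertex_separation[OF T] uv x by blast+
  then show False using x(2) by simp
qed

text \<open>A path that starts inside an edge and leaves its interior passes through one of its ends:
  otherwise the open interior of the edge and the open complement of the compact edge would
  disconnect the path.\<close>

lemma edge_around_nonvertex: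
  assumes T: "simplicial_tree T V" and z: "z \<in> T" "z \<notin> V"
  obtains u v E where "u \<in> V" "v \<in> V" "dist u v = 1" "is_edge T V E" "z \<in> E"
    "\<And>x. x \<in> E \<Longrightarrow> x \<in> T \<and> dist u x + dist x v = 1"
    "\<And>w. w \<in> T \<Longrightarrow> w \<notin> E - V \<Longrightarrow> dist z w = dist z u + dist u w \<or> dist z w = dist z v + dist v w"
proof -
  have rt: "real_tree T" by (rule simplicial_tree_real_tree[OF T])
  obtain E where E: "is_edge T V E" "z \<in> E" using simplicial_tree_edge_cover[OF T z] by blast
  then obtain u v where uv: "u \<in> V" "v \<in> V" "dist u v = 1" and seg: "geodesic_segment T u v E"
    by (auto simp: is_edge_def)
  have in_E: "x \<in> T \<and> dist u x + dist x v = 1" if "x \<in> E" for x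
    using geodesic_segment_between[OF seg that] geodesic_segment_ends(5)[OF seg] that uv by auto
  have exit: "dist z w = dist z u + dist u w \<or> dist z w = dist z v + dist v w"
    if w: "w \<in> T" "w \<notin> E - V" for w
  proof (rule ccontr)
    assume n: "\<not> ?thesis"
    obtain S where S: "geodesic_segment T z w S" using rt z w unfolding real_tree_def by meson
    have avoid: "u \<notin> S" "v \<notin> S" using geodesic_segment_between[OF S] n by metis+
    obtain U where U: "open U" "E - V = T \<inter> U"
    proof -
      have "openin (top_of_set T) (E - V)" by (rule simplicial_tree_open_edge[OF T E(1)])
      then show ?thesis using that by (auto simp: openin_open)
    qed
    have ST: "S \<subseteq> T" "z \<in> S" "w \<in> S" using geodesic_segment_ends[OF S] by auto
    have SE: "S \<inter> E \<subseteq> S \<inter> U"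
    proof
      fix x assume x: "x \<in> S \<inter> E"
      then have "x \<notin> V" using edge_vertices[OF T uv] in_E avoid by blast
      then show "x \<in> S \<inter> U" using x U(2) by blast
    qed
    have "closed E"
      using geodesic_segment_compact_connected(1)[OF seg] by (rule compact_imp_closed)
    moreover have "U \<inter> (- E) \<inter> S = {}" using U(2) ST by blast
    moreover have "S \<subseteq> U \<union> - E" using SE by blast
    moreover have "z \<in> U" using E(2) z U(2) by blast
    moreover have "w \<in> - E"
      using w(2) SE ST U(2) by blast
    ultimately show False
      using connectedD[OF geodesic_segment_compact_connected(2)[OF S] U(1), of "- E"] ST(2,3)
      by (auto simp: open_Compl)
  qed
  show thesis using that[OF uv E in_E exit] by blast
qed

text \<open>An interior point of an edge has a neighbourhood isometric to an interval, in which no three points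
  at the same small distance \<open>h\<close> from \<open>q\<close> have pairwise distances \<open>2 h\<close>.\<close>

lemma branch_point_vertex:
  assumes T: "simplicial_tree T V"
    and in_T: "r \<in> T" "s \<in> T" "t \<in> T" and ne: "q \<noteq> r"
    and mids: "metric_tree.mid T q r s" "metric_tree.mid T q s t" "metric_tree.mid T q r t"
  shows "q \<in> V"
proof (rule ccontr)
  assume nV: "q \<notin> V"
  interpret metric_tree T using T by (rule simplicial_tree_metric_tree)
  define d where "d = dist q r"
  have d: "d > 0" using ne by (simp add: d_def)
  have ds: "dist q r = d" "dist q s = d" "dist q t = d" "dist r s = 2 * d" "dist s t = 2 * d" "dist r t = 2 * d"
    using mids by (auto simp: mid_def d_def dist_commute)
  have qT: "q \<in> T" using mids by (simp add: mid_def)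
  obtain u v E where E: "u \<in> V" "v \<in> V" "dist u v = 1" "is_edge T V E" "q \<in> E"
    "\<And>x. x \<in> E \<Longrightarrow> x \<in> T \<and> dist u x + dist x v = 1"
    by (rule edge_around_nonvertex[OF T qT nV]) blast
  have uvT: "u \<in> T" "v \<in> T" using E(1,2) simplicial_tree_vertices[OF T] by auto
  obtain e where e: "e > 0" "ball q e \<inter> T \<subseteq> E - V"
  proof -
    have "openin (top_of_set T) (E - V)" by (rule simplicial_tree_open_edge[OF T E(4)])
    moreover have "q \<in> E - V" using E(5) nV by simp
    ultimately have "\<exists>e>0. ball q e \<inter> T \<subseteq> E - V" unfolding openin_contains_ball by blast
    then show ?thesis using that by blast
  qed
  define h where "h = min d (e / 2)"
  have h: "0 < h" "h \<le> d" "h < e" using d e by (auto simp: h_def)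
  have near: "\<exists>y\<in>E. dist q y = h \<and> dist y x = d - h" if x: "x \<in> T" "dist q x = d" for x
    using segment_point[OF qT x(1), of h] h x e(2) by fastforce
  obtain r' s' t' where p: "r' \<in> E" "dist q r' = h" "dist r' r = d - h"
    "s' \<in> E" "dist q s' = h" "dist s' s = d - h" "t' \<in> E" "dist q t' = h" "dist t' t = d - h"
    using near[OF in_T(1) ds(1)] near[OF in_T(2) ds(2)] near[OF in_T(3) ds(3)] by blast
  have far: "dist y y' = 2 * h" if "dist q y = h" "dist q y' = h" "dist y x = d - h" "dist y' x' = d - h"
    "dist x x' = 2 * d" for x x' y y'
    using that dist_triangle[of y y' q] dist_triangle[of x x' y] dist_triangle[of y x' y']
    by (simp add: dist_commute)
  have coord: "dist y y' = \<bar>dist u y - dist u y'\<bar>" if "y \<in> E" "y' \<in> E" for y y'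
    using between_dist[OF uvT, of y y'] E(3,6) that by simp
  have "dist r' s' = 2 * h" "dist s' t' = 2 * h" "dist r' t' = 2 * h"
    using far p ds(4-6) by blast+
  then show False
    using coord[OF p(1,4)] coord[OF p(4,7)] coord[OF p(1,7)] h(1) by linarith
qed

text \<open>The point \<open>z\<close> at distance \<open>1/2\<close> from \<open>u\<close> on the way to \<open>w\<close> is not a vertex, so it lies in an edge.
  The way back to \<open>u\<close> leaves this edge through an end within \<open>1/2\<close> of \<open>u\<close>, which must be \<open>u\<close>
  itself; the way on to \<open>w\<close> leaves it through the other end.\<close>

lemma vertex_one_step:
  assumes T: "simplicial_tree T V" and u: "u \<in> V" and w: "w \<in> T" and d: "1 \<le> dist u w"
  shows "\<exists>v\<in>V. dist u v = 1 \<and> dist u v + dist v w = dist u w"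
proof -
  interpret metric_tree T using T by (rule simplicial_tree_metric_tree)
  have sep: "1 \<le> dist x y" if "x \<in> V" "y \<in> V" "x \<noteq> y" for x y
    using simplicial_tree_vertex_separation[OF T] that by blast
  have VT: "V \<subseteq> T" by (rule simplicial_tree_vertices[OF T])
  obtain z where z: "z \<in> T" "dist u z = 1/2" "dist z w = dist u w - 1/2"
    using segment_point[of u w "1/2"] u w d VT by auto
  have "z \<notin> V" using sep[of u z] u z by (cases "u = z") auto
  then obtain p v E where E: "p \<in> V" "v \<in> V" "dist p v = 1" "z \<in> E"
      "\<And>x. x \<in> E \<Longrightarrow> x \<in> T \<and> dist p x + dist x v = 1"
      "\<And>w. w \<in> T \<Longrightarrow> w \<notin> E - V \<Longrightarrow> dist z w = dist z p + dist p w \<or> dist z w = dist z v + dist v w"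
    by (rule edge_around_nonvertex[OF T z(1)]) blast
  have up: "u = p \<or> u = v"
  proof (rule ccontr)
    assume n: "\<not> ?thesis"
    have "dist z u = dist z p + dist p u \<or> dist z u = dist z v + dist v u"
      using E(6)[of u] u VT by blast
    moreover have "1 \<le> dist p u" "1 \<le> dist v u" using n sep E(1,2) u by auto
    ultimately show False
      using z(2) dist_commute[of z u] zero_le_dist[of z p] zero_le_dist[of z v] by linarith
  qed
  have *: "dist u v' = 1 \<and> dist u v' + dist v' w = dist u w"
    if e: "dist u v' = 1" and z': "dist u z + dist z v' = 1"
      and E: "w \<notin> E - V \<Longrightarrow> dist z w = dist z u + dist u w \<or> dist z w = dist z v' + dist v' w"
        "w \<in> E \<Longrightarrow> dist u w + dist w v' = 1" and v': "v' \<in> V" for v'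
  proof (cases "w \<in> E - V")
    case True
    then have "dist w v' > 0" "dist u w + dist w v' = 1" using v' E(2) by auto
    then have False using d by linarith
    then show ?thesis ..
  next
    case False
    then show ?thesis using E(1) e z z' dist_commute[of z u] by auto
  qed
  show ?thesis
    using up
  proof
    assume "u = p"
    then show ?thesis using *[of v] E(2-6) w by (intro bexI[of _ v]) blast+
  next
    assume "u = v"
    have "dist u p + dist p w = dist u w \<and> dist u p = 1"
    proof -
      have "dist u p = 1" using E(3) \<open>u = v\<close> by (simp add: dist_commute)
      moreover have "dist u x + dist x p = 1" if "x \<in> E" for x
        using E(5)[OF that] dist_commute[of p x] dist_commute[of x v] unfolding \<open>u = v\<close> by linarith
      ultimately show ?thesis using *[of p] E(1,4) E(6)[OF w] \<open>u = v\<close> by blast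
    qed
    then show ?thesis using E(1) by blast
  qed
qed

lemma vertex_dist_Ints:
  assumes T: "simplicial_tree T V" and u: "u \<in> V" and w: "w \<in> V"
  shows "dist u w \<in> \<int>"
  using u
proof (induction "nat \<lfloor>dist u w\<rfloor>" arbitrary: u rule: less_induct)
  case less
  show ?case
  proof (cases "u = w")
    case False
    then have d: "1 \<le> dist u w" and wT: "w \<in> T" 
      using simplicial_tree_vertex_separation[OF T less.prems w] simplicial_tree_vertices[OF T] w by auto
    obtain v where v: "v \<in> V" "dist u v = 1" "dist u v + dist v w = dist u w"
      using vertex_one_step[OF T less.prems wT d] by blast
    then have eq: "dist u w = dist v w + 1" by simp
    then have "nat \<lfloor>dist v w\<rfloor> < nat \<lfloor>dist u w\<rfloor>" using d by linarith
    then show ?thesis using less.hyps[OF _ v(1)] unfolding eq by simp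
  qed simp
qed

text \<open>The end \<open>u\<close> of the edge around \<open>p\<close> that faces \<open>q\<close> has integral distance from \<open>q\<close>, so its distance
  from \<open>p\<close> is a half-integer strictly between \<open>0\<close> and \<open>1\<close>.\<close>

lemma half_integer_point:
  assumes T: "simplicial_tree T V" and q: "q \<in> V" and p: "p \<in> T" "p \<notin> V"
    and half: "2 * dist p q \<in> \<int>"
  obtains u v where "u \<in> V" "v \<in> V" "dist u v = 1" "dist p u = 1/2" "dist p v = 1/2"
    "dist p q = 1/2 + dist u q"
    "\<And>w. w \<in> V \<Longrightarrow> dist p w = 1/2 + dist u w \<or> dist p w = 1/2 + dist v w"
proof -
  have VT: "V \<subseteq> T" by (rule simplicial_tree_vertices[OF T])
  note result = that
  have key: thesis
    if uv: "u \<in> V" "v \<in> V" "dist u v = 1" "dist u p + dist p v = 1"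
      and via: "dist p q = dist p u + dist u q"
      and exit: "\<And>w. w \<in> V \<Longrightarrow> dist p w = dist p u + dist u w \<or> dist p w = dist p v + dist v w"
    for u v
  proof -
    obtain i where i: "2 * dist p q = of_int i" using half by (auto elim: Ints_cases)
    obtain j where j: "dist u q = of_int j" using vertex_dist_Ints[OF T uv(1) q] by (auto elim: Ints_cases)
    have "0 < dist p u" "0 < dist p v" using p uv by auto
    then have "0 < 2 * dist p u" "2 * dist p u < 2" using uv(4) dist_commute[of p u] by linarith+
    moreover have "2 * dist p u = of_int (i - 2 * j)" using via i j by simp
    ultimately have "i - 2 * j = 1" by linarith
    then have "dist p u = 1/2" using \<open>2 * dist p u = of_int (i - 2 * j)\<close> by simp
    moreover from this have "dist p v = 1/2" using uv(4) dist_commute[of p u] by simp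
    ultimately show thesis
      using result[OF uv(1-3)] via exit by metis
  qed
  obtain u v E where E: "u \<in> V" "v \<in> V" "dist u v = 1" "p \<in> E"
      "\<And>x. x \<in> E \<Longrightarrow> x \<in> T \<and> dist u x + dist x v = 1"
      "\<And>w. w \<in> T \<Longrightarrow> w \<notin> E - V \<Longrightarrow> dist p w = dist p u + dist u w \<or> dist p w = dist p v + dist v w"
    by (rule edge_around_nonvertex[OF T p]) blast
  have exit: "dist p w = dist p u + dist u w \<or> dist p w = dist p v + dist v w" if "w \<in> V" for w
    using E(6)[of w] that VT by blast
  show thesis
    using exit[OF q]
  proof
    assume "dist p q = dist p u + dist u q"
    then show thesis using key[of u v] E exit by blast
  next
    assume "dist p q = dist p v + dist v q"
    then show thesis using key[of v u] E exit by (simp add: dist_commute add.commute disj_commute)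
  qed
qed

lemma isometric_action_tree_action:
  assumes "simplicial_tree T V" "isometric_action G T \<phi>"
  shows "tree_action T G \<phi>"
proof -
  interpret metric_tree T using assms(1) by (rule simplicial_tree_metric_tree)
  interpret group_action G T \<phi> using assms(2) by (simp add: isometric_action_def)
  interpret group G by (rule group_hom.axioms(1)[OF group_hom])
  show ?thesis
  proof
    show "\<phi> g x \<in> T" if "g \<in> carrier G" "x \<in> T" for g x
      using element_image[OF that HOL.refl] .
    show "\<phi> (g \<otimes>\<^bsub>G\<^esub> h) x = \<phi> g (\<phi> h x)" if "g \<in> carrier G" "h \<in> carrier G" "x \<in> T" for g h x
      using composition_rule[OF that(3,1,2)] .
    show "\<phi> \<one>\<^bsub>G\<^esub> x = x" if "x \<in> T" for x
      using that id_eq_one by (metis restrict_apply')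
    show "dist (\<phi> g x) (\<phi> g y) = dist x y" if "g \<in> carrier G" "x \<in> T" "y \<in> T" for g x y
      using assms(2) that unfolding isometric_action_def by blast
  qed
qed

section \<open>Bridges and minimal actions on simplicial trees\<close>

context tree_action
begin

text \<open>The vertices \<open>q\<close> and \<open>\<Delta> q\<close> have integral distance and midpoint \<open>p\<close>. If \<open>p\<close> is the midpoint of
  an edge from \<open>u\<close> to \<open>v\<close>, with \<open>u\<close> facing \<open>q\<close>, then \<open>v\<close> faces \<open>\<Delta> q\<close>, so \<open>\<Delta>\<close> sends \<open>u\<close> to \<open>v\<close>; its
  square fixes \<open>p\<close> and \<open>q\<close>, hence also \<open>u\<close>, and thus \<open>\<Delta>\<close> exchanges \<open>u\<close> and \<open>v\<close>.\<close>

lemma dihedral_bridge_vertices: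
  assumes ab: "odd_dihedral G a b k" and br: "dihedral_bridge a b k p q" and T: "simplicial_tree T V"
  shows "q \<in> V" "p \<in> subdivision_vertices T V" "without_inversions G V \<phi> \<Longrightarrow> p \<in> V"
proof -
  interpret odd_dihedral G a b k by fact
  obtain r s where rs: "r \<in> T" "s \<in> T" "mid q p r" "mid q r s" "mid q p s"
    using br by (auto simp: dihedral_bridge_def)
  have pT: "p \<in> T" and qT: "q \<in> T" using br axis_in by (auto simp: dihedral_bridge_def)
  have ne: "q \<noteq> p" and \<Delta>p: "\<phi> \<Delta> p = p" and m: "mid p q (\<phi> \<Delta> q)"
    using br by (auto simp: dihedral_bridge_def \<Delta>_def)
  show qV: "q \<in> V" using branch_point_vertex[OF T pT rs(1,2) ne rs(3-5)] .
  have \<Delta>qV: "\<phi> \<Delta> q \<in> V"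
    using branch_point_vertex[OF T, of "\<phi> \<Delta> p" "\<phi> \<Delta> r" "\<phi> \<Delta> s" "\<phi> \<Delta> q"] pT qT rs ne by simp
  have d: "2 * dist p q = dist q (\<phi> \<Delta> q)" "dist p (\<phi> \<Delta> q) = dist p q"
    using m by (auto simp: mid_def dist_commute)
  have half: "2 * dist p q \<in> \<int>" unfolding d(1) by (rule vertex_dist_Ints[OF T qV \<Delta>qV])
  have VT: "V \<subseteq> T" by (rule simplicial_tree_vertices[OF T])
  show "p \<in> subdivision_vertices T V"
  proof (cases "p \<in> V")
    case False
    then obtain u v where "u \<in> V" "v \<in> V" "dist u v = 1" "dist p u = 1/2" "dist p v = 1/2"
      by (rule half_integer_point[OF T qV pT _ half]) blast
    then have "u \<in> V" "v \<in> V" "dist u v = 1" "dist u p = 1/2" "dist p v = 1/2"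
      using dist_commute[of u p] by simp_all
    then show ?thesis using pT unfolding subdivision_vertices_def by blast
  qed (simp add: subdivision_vertices_def)
  show "p \<in> V" if ninv: "without_inversions G V \<phi>"
  proof (rule ccontr)
    assume "p \<notin> V"
    then obtain u v where uv: "u \<in> V" "v \<in> V" "dist u v = 1" "dist p u = 1/2" "dist p v = 1/2"
      "dist p q = 1/2 + dist u q"
      "\<And>w. w \<in> V \<Longrightarrow> dist p w = 1/2 + dist u w \<or> dist p w = 1/2 + dist v w"
      by (rule half_integer_point[OF T qV pT _ half]) blast
    have uvT: "u \<in> T" "v \<in> T" using uv VT by auto
    have v: "dist p (\<phi> \<Delta> q) = 1/2 + dist v (\<phi> \<Delta> q)"
      using uv(7)[OF \<Delta>qV] uv(6) d dist_triangle[of q "\<phi> \<Delta> q" u] dist_commute[of q u] by linarith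
    have \<Delta>u: "dist p (\<phi> \<Delta> u) = 1/2" "dist (\<phi> \<Delta> u) (\<phi> \<Delta> q) = dist u q"
      using act_dist[OF Delta pT uvT(1)] uv(4) \<Delta>p uvT qT by simp_all
    have "\<phi> \<Delta> u = v"
      using between_dist[of p "\<phi> \<Delta> q" "\<phi> \<Delta> u" v] v \<Delta>u uv d(2) uvT pT qT by simp
    moreover have "\<phi> \<Delta> v = u"
    proof -
      have "\<Delta> \<otimes> \<Delta> = (a \<otimes> b) [^] (2 * k + 1)" by (rule Delta_square)
      then have "\<phi> (\<Delta> \<otimes> \<Delta>) q = q"
        using fixed_pow[of "a \<otimes> b" q "2 * k + 1"] br qT by (simp add: dihedral_bridge_def)
      then have "\<phi> (\<Delta> \<otimes> \<Delta>) u = u"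
        using fixed_between[of "\<Delta> \<otimes> \<Delta>" p q u] \<Delta>p pT qT uvT uv(4,6) by simp
      then show ?thesis using \<open>\<phi> \<Delta> u = v\<close> uvT by simp
    qed
    ultimately show False using ninv uv(1-3) Delta unfolding without_inversions_def by blast
  qed
qed

lemma minimal_fixed_point:
  assumes "minimal_action G T \<phi>" and x: "x \<in> T" "\<And>g. g \<in> carrier G \<Longrightarrow> \<phi> g x = x"
  shows "T = {x}"
proof -
  have "\<forall>g\<in>carrier G. \<phi> g ` {x} = {x}" using x by simp
  then show ?thesis
    using assms(1)[unfolded minimal_action_def, rule_format, of "{x}"] x(1) by simp
qed

text \<open>The line is connected, as the isometric image of the real line under the inverse of its coordinate,
  and it is invariant; so minimality applies.\<close>

lemma minimal_line:
  assumes min: "minimal_action G T \<phi>" and f: "line_coord L f"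
    and s: "\<And>g. g \<in> carrier G \<Longrightarrow> \<exists>\<sigma>. shift L f g \<sigma>"
  shows "line_by_translations G T \<phi>"
proof -
  define r where "r t = (SOME x. x \<in> L \<and> f x = t)" for t
  have r: "r t \<in> L" "f (r t) = t" for t
    using someI_ex[of "\<lambda>x. x \<in> L \<and> f x = t"] line_coord_ex[OF f, of t] unfolding r_def by blast+
  have Lr: "L = range r"
  proof (intro equalityI subsetI)
    fix x assume "x \<in> L"
    then have "x = r (f x)" using line_coord_inj[OF f] r by metis
    then show "x \<in> range r" by blast
  qed (use r in auto)
  have "continuous_on UNIV r"
    unfolding continuous_on_iff using line_coord_dist[OF f r(1) r(1)] r(2) by (auto simp: dist_real_def)
  then have "connected L" unfolding Lr by (rule connected_continuous_image) simp
  moreover have "\<phi> g ` L = L" if g: "g \<in> carrier G" for g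
  proof -
    obtain \<sigma> \<tau> where "shift L f g \<sigma>" "shift L f (inv g) \<tau>" using s g inv_closed by metis
    then have "\<phi> g ` L \<subseteq> L" "\<phi> (inv g) ` L \<subseteq> L" by (auto simp: shift_def)
    then show ?thesis using g line_coord_in[OF f] by (force simp: image_iff)
  qed
  moreover have "L \<subseteq> T" "L \<noteq> {}" using f r(1) by (auto simp: line_coord_def)
  ultimately have "L = T"
    using min[unfolded minimal_action_def, rule_format, of L] by simp
  then show ?thesis
    using f s unfolding line_by_translations_def line_coord_def shift_def
    by (intro exI[of _ f]) (force simp: dist_real_def)
qed

end

section \<open>Generation by the standard generators, and stabilizers\<close>

lemma presented_group_generated:
  assumes H: "subgroup H (presented_group R)" and gens: "\<And>x. pres_gen R x \<in> H"
  shows "H = carrier (presented_group R)"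
proof
  show "H \<subseteq> carrier (presented_group R)" using H by (rule subgroup.subset)
  interpret group "presented_group R" by (rule group_presented_group)
  have letter: "pres_class R [(x, s)] \<in> H" for x s
  proof (cases s)
    case True then show ?thesis using gens[of x] by (simp add: pres_gen_def)
  next
    case False
    have "pres_class R [(x, True)] \<otimes>\<^bsub>presented_group R\<^esub> pres_class R [(x, False)] = \<one>\<^bsub>presented_group R\<^esub>"
      using pres_eq.cancel[of R x True] by (simp add: mult_presented_group one_presented_group pres_class_eq_iff)
    then have "pres_class R [(x, False)] = inv\<^bsub>presented_group R\<^esub> (pres_gen R x)"
      by (metis carrier_presented_group inv_equality inv_inv pres_gen_closed pres_gen_def rangeI)
    then show ?thesis using subgroup.m_inv_closed[OF H gens] False by simp
  qed
  have "pres_class R u \<in> H" for u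
  proof (induction u)
    case Nil then show ?case using subgroup.one_closed[OF H] by (simp add: one_presented_group)
  next
    case (Cons y u)
    then show ?case
      using subgroup.m_closed[OF H letter[of "fst y" "snd y"]] mult_presented_group[of R "[y]" u] by fastforce
  qed
  then show "carrier (presented_group R) \<subseteq> H" by (auto simp: carrier_presented_group)
qed

lemma Artin_2_odd_odd_generated:
  assumes "subgroup H (Artin_2_odd_odd n m)"
    and "artin_elt n m GenA \<in> H" "artin_elt n m GenB \<in> H" "artin_elt n m GenC \<in> H"
  shows "H = carrier (Artin_2_odd_odd n m)"
  unfolding Artin_2_odd_odd_def
proof (rule presented_group_generated)
  show "pres_gen (artin_relations n m) x \<in> H" for x
    using assms(2-4) by (cases x) (simp_all add: artin_elt_def)
qed (use assms(1) in \<open>simp add: Artin_2_odd_odd_def\<close>)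

context tree_action
begin

lemma Fix_empty_iff: "Fix T \<phi> g = {} \<longleftrightarrow> \<not> elliptic g"
  by (auto simp: Fix_def elliptic_def)

lemma subgroup_shifts:
  assumes "line_coord L f"
  shows "subgroup {g \<in> carrier G. \<exists>\<sigma>. shift L f g \<sigma>} G"
proof (rule subgroupI)
  show "{g \<in> carrier G. \<exists>\<sigma>. shift L f g \<sigma>} \<noteq> {}" using shift_one[OF assms] by blast
next
  fix g h assume "g \<in> {g \<in> carrier G. \<exists>\<sigma>. shift L f g \<sigma>}" "h \<in> {g \<in> carrier G. \<exists>\<sigma>. shift L f g \<sigma>}"
  then show "inv g \<in> {g \<in> carrier G. \<exists>\<sigma>. shift L f g \<sigma>}" "g \<otimes> h \<in> {g \<in> carrier G. \<exists>\<sigma>. shift L f g \<sigma>}"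
    using shift_mult[OF _ _ assms] shift_inv[OF _ assms] by blast+
qed auto

lemma subgroup_fixing: "x \<in> T \<Longrightarrow> subgroup (stabilizer G \<phi> x) G"
  by (rule subgroupI) (auto simp: stabilizer_def fixed_inv intro: exI[of _ \<one>])

lemma generate_fixes:
  assumes "x \<in> T" "\<And>g. g \<in> K \<Longrightarrow> g \<in> carrier G \<and> \<phi> g x = x"
  shows "generate G K \<subseteq> stabilizer G \<phi> x"
  by (rule generate_subgroup_incl[OF _ subgroup_fixing]) (use assms in \<open>auto simp: stabilizer_def\<close>)

text \<open>All memberships come from \<open>\<Delta> = x^m a = b x^m\<close> and \<open>D = y^n c = b y^n\<close> together with the
  agreement of \<open>a\<close> and \<open>c\<close> on their axis, where \<open>x = a b\<close>, \<open>y = c b\<close> and \<open>D\<close> is the analogue of \<open>\<Delta>\<close>: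
  at \<open>p\<close>, the powers \<open>x^m\<close> and \<open>y^n\<close> both act as \<open>b^(-1)\<close>, and their inverses both act as \<open>a\<close>.\<close>

lemma bridge_stabilizers:
  assumes ab: "odd_dihedral G a b m" and cb: "odd_dihedral G c b n" and ac: "a \<otimes> c = c \<otimes> a"
    and hyp: "\<not> elliptic a"
    and pq: "dihedral_bridge a b m p q" and pq': "dihedral_bridge c b n p q"
  shows "generate G {c \<otimes> b, a \<otimes> b} \<subseteq> stabilizer G \<phi> q"
    and "generate G {(c \<otimes> b) [^] n \<otimes> c, (a \<otimes> b) [^] m \<otimes> a} \<subseteq> stabilizer G \<phi> p"
    and "generate G {(a \<otimes> b) \<otimes> inv (c \<otimes> b), inv ((c \<otimes> b) [^] n) \<otimes> (a \<otimes> b) [^] m,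
        (c \<otimes> b) [^] n \<otimes> inv ((a \<otimes> b) [^] m), (c \<otimes> b) [^] (2 * n + 1), (a \<otimes> b) [^] (2 * m + 1)}
      \<subseteq> path_stabilizer G \<phi> p q"
proof -
  interpret A: odd_dihedral G a b m by fact
  interpret C: odd_dihedral G c b n by fact
  note G = A.a A.b C.a
  have T: "p \<in> T" "q \<in> T" and p_axis: "p \<in> axis a" using pq axis_in by (auto simp: dihedral_bridge_def)
  define x y where "x = a \<otimes> b" and "y = c \<otimes> b"
  have xy: "x \<in> carrier G" "y \<in> carrier G" using G by (simp_all add: x_def y_def)
  have q: "\<phi> x q = q" "\<phi> y q = q" using pq pq' by (simp_all add: dihedral_bridge_def x_def y_def)
  have D: "\<phi> A.\<Delta> p = p" "\<phi> C.\<Delta> p = p"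
    using pq pq' by (simp_all add: dihedral_bridge_def A.\<Delta>_def C.\<Delta>_def)
  have agree: "\<phi> c z = \<phi> a z" if "z \<in> axis a" for z
    using dihedral_bridges_agree(3)[OF ab cb ac hyp pq pq' that] .
  have pow_q: "\<phi> (x [^] k) q = q" "\<phi> (y [^] k) q = q" for k :: nat
    using fixed_pow xy q T by auto
  have xap: "\<phi> (x [^] m) (\<phi> a p) = p" and yap: "\<phi> (y [^] n) (\<phi> a p) = p"
    using D G xy T agree[OF p_axis] by (simp_all add: A.\<Delta>_def C.\<Delta>_def x_def y_def)
  have bxp: "\<phi> b (\<phi> (x [^] m) p) = p" and byp: "\<phi> b (\<phi> (y [^] n) p) = p"
    using D G xy T by (simp_all add: A.Delta_eq C.Delta_eq x_def y_def)
  show "generate G {c \<otimes> b, a \<otimes> b} \<subseteq> stabilizer G \<phi> q"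
    using q xy by (intro generate_fixes T) (auto simp: x_def y_def)
  show "generate G {(c \<otimes> b) [^] n \<otimes> c, (a \<otimes> b) [^] m \<otimes> a} \<subseteq> stabilizer G \<phi> p"
    using D G A.Delta C.Delta unfolding A.\<Delta>_def C.\<Delta>_def by (intro generate_fixes T) blast
  define K where "K = {x \<otimes> inv y, inv (y [^] n) \<otimes> x [^] m, y [^] n \<otimes> inv (x [^] m),
    y [^] (2 * n + 1), x [^] (2 * m + 1)}"
  have KG: "K \<subseteq> carrier G" using xy by (simp add: K_def)
  have Kq: "\<phi> g q = q" if "g \<in> K" for g
  proof -
    have "\<phi> (inv y) q = q" "\<phi> (inv (x [^] m)) q = q" "\<phi> (inv (y [^] n)) q = q"
      using fixed_inv q pow_q xy T by auto
    then show ?thesis using that q pow_q xy T unfolding K_def by (auto simp del: nat_pow_Suc)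
  qed
  have Kp: "\<phi> g p = p" if "g \<in> K" for g
  proof -
    have "\<phi> (x \<otimes> inv y) p = p"
    proof -
      have "b \<otimes> (inv b \<otimes> inv c) = inv c" using G m_assoc[of b "inv b" "inv c"] by simp
      then have "x \<otimes> inv y = a \<otimes> inv c" using G by (simp add: x_def y_def inv_mult_group m_assoc)
      moreover have "\<phi> (inv c) p \<in> axis a"
      proof -
        have "inv c \<otimes> a \<otimes> c = a"
          using G ac m_assoc[of "inv c" c a] m_assoc[of "inv c" a c] by simp
        then have "inv c \<otimes> a = a \<otimes> inv c" using G inv_solve_right[of "inv c \<otimes> a" a c] by simp
        then show ?thesis using axis_act_commute[OF G(1) _ _ p_axis] G by simp
      qed
      ultimately show ?thesis using agree[of "\<phi> (inv c) p"] G T by simp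
    qed
    moreover have "\<phi> (inv (y [^] n) \<otimes> x [^] m) p = p"
    proof -
      have "\<phi> (x [^] m) p = \<phi> (y [^] n) p"
        using bxp byp G xy T by (metis act_eq_iff act_in nat_pow_closed)
      then show ?thesis using xy T by simp
    qed
    moreover have "\<phi> (y [^] n \<otimes> inv (x [^] m)) p = p"
    proof -
      have "\<phi> (inv (x [^] m)) p = \<phi> a p" using xap G xy T by (metis act_in act_inv_act nat_pow_closed)
      then show ?thesis using yap xy T by simp
    qed
    moreover have "\<phi> (y [^] (2 * n + 1)) p = p" "\<phi> (x [^] (2 * m + 1)) p = p"
      unfolding x_def y_def A.Delta_square[symmetric] C.Delta_square[symmetric]
      using D T by simp_all
    ultimately show ?thesis using that unfolding K_def by blast
  qed
  have "generate G K \<subseteq> path_stabilizer G \<phi> p q"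
    unfolding path_stabilizer_def
    using generate_fixes[OF T(1), of K] generate_fixes[OF T(2), of K] Kp Kq KG by blast
  then show "generate G {(a \<otimes> b) \<otimes> inv (c \<otimes> b), inv ((c \<otimes> b) [^] n) \<otimes> (a \<otimes> b) [^] m,
        (c \<otimes> b) [^] n \<otimes> inv ((a \<otimes> b) [^] m), (c \<otimes> b) [^] (2 * n + 1), (a \<otimes> b) [^] (2 * m + 1)}
      \<subseteq> path_stabilizer G \<phi> p q"
    unfolding K_def x_def y_def .
qed

end

theorem theorem4p5:
  fixes n m :: nat
    and G (structure)
    and a b c :: "artin_gen word set"
    and T V :: "'a::metric_space set"
    and \<phi> :: "artin_gen word set \<Rightarrow> 'a \<Rightarrow> 'a"
  assumes "n \<ge> 1" and "m \<ge> 1"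
    and "G = Artin_2_odd_odd n m"
    and "a = artin_elt n m GenA" and "b = artin_elt n m GenB" and "c = artin_elt n m GenC"
    and "simplicial_tree T V"
    and "isometric_action G T \<phi>"
    and "minimal_action G T \<phi>"
  shows "(Fix T \<phi> a \<noteq> {} \<longrightarrow> (\<exists>x. T = {x})) \<and>
    (Fix T \<phi> a = {} \<and> (Fix T \<phi> (a \<otimes> b) = {} \<or> Fix T \<phi> (c \<otimes> b) = {})
      \<longrightarrow> line_by_translations G T \<phi>) \<and>
    (Fix T \<phi> a = {} \<and> Fix T \<phi> (a \<otimes> b) \<noteq> {} \<and> Fix T \<phi> (c \<otimes> b) \<noteq> {} \<longrightarrow>
      (\<exists>p0 q0 e.
        p0 \<in> subdivision_vertices T V \<and> q0 \<in> subdivision_vertices T V \<and>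
        (without_inversions G V \<phi> \<longrightarrow> p0 \<in> V \<and> q0 \<in> V) \<and>
        geodesic_segment T p0 q0 e \<and>
        generate G {c \<otimes> b, a \<otimes> b} \<subseteq> stabilizer G \<phi> q0 \<and>
        generate G {(c \<otimes> b) [^] n \<otimes> c, (a \<otimes> b) [^] m \<otimes> a} \<subseteq> stabilizer G \<phi> p0 \<and>
        generate G {(a \<otimes> b) \<otimes> inv (c \<otimes> b),
                    inv ((c \<otimes> b) [^] n) \<otimes> (a \<otimes> b) [^] m,
                    (c \<otimes> b) [^] n \<otimes> inv ((a \<otimes> b) [^] m),
                    (c \<otimes> b) [^] (2 * n + 1),
                    (a \<otimes> b) [^] (2 * m + 1)}
          \<subseteq> path_stabilizer G \<phi> p0 q0))"
proof -
  interpret tree_action T G \<phi> using assms(7,8) by (rule isometric_action_tree_action)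
  have G: "a \<in> carrier G" "b \<in> carrier G" "c \<in> carrier G"
    using assms(3-6) by (simp_all add: artin_elt_closed)
  note rels = Artin_2_odd_odd_relations[OF assms(3-6)]
  have ab: "odd_dihedral G a b m"
    by unfold_locales (use G rels in auto)
  have "(c \<otimes> b) [^] n \<otimes> c = b \<otimes> (c \<otimes> b) [^] n"
    using rels(2) pow_mult_swap[OF G(3,2)] pow_mult_swap[OF G(2,3)] by simp
  then have cb: "odd_dihedral G c b n"
    by unfold_locales (use G in auto)
  have ell: "elliptic b \<longleftrightarrow> elliptic a" "elliptic c \<longleftrightarrow> elliptic a"
    using dihedral_elliptic_iff[OF ab] dihedral_elliptic_iff[OF cb] by simp_all
  have gen: "H = carrier G" if "subgroup H G" "a \<in> H" "b \<in> H" "c \<in> H" for H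
    using Artin_2_odd_odd_generated that assms(3-6) by blast
  have ne: "T \<noteq> {}"
    using simplicial_tree_real_tree[OF assms(7)] by (simp add: real_tree_def)

  have "\<exists>x. T = {x}" if e: "elliptic a"
  proof -
    obtain x where x: "x \<in> T" "\<phi> a x = x" "\<phi> b x = x" "\<phi> c x = x"
      using global_fixed_point[OF ab cb rels(1) e] by blast
    then have "stabilizer G \<phi> x = carrier G"
      using G by (intro gen subgroup_fixing) (simp_all add: stabilizer_def)
    then show ?thesis using minimal_fixed_point[OF assms(9) x(1)] by (auto simp: stabilizer_def)
  qed
  moreover have "line_by_translations G T \<phi>"
    if hyp: "\<not> elliptic a" and xy: "\<not> elliptic (a \<otimes> b) \<or> \<not> elliptic (c \<otimes> b)"
  proof -
    obtain L f \<alpha> \<beta> \<gamma> where L: "line_coord L f"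
      and s: "shift L f a \<alpha>" "shift L f b \<beta>" "shift L f c \<gamma>"
      using xy
    proof
      assume "\<not> elliptic (a \<otimes> b)"
      then show thesis using dihedral_line[OF ab G(3) rels(1) hyp _ ne] that by blast
    next
      assume "\<not> elliptic (c \<otimes> b)"
      then show thesis using dihedral_line[OF cb G(1) rels(1)[symmetric] _ _ ne] hyp ell that by blast
    qed
    have "{g \<in> carrier G. \<exists>\<sigma>. shift L f g \<sigma>} = carrier G"
      using G s by (intro gen subgroup_shifts[OF L]) auto
    then show ?thesis using minimal_line[OF assms(9) L] by blast
  qed
  moreover have "\<exists>p0 q0 e.
        p0 \<in> subdivision_vertices T V \<and> q0 \<in> subdivision_vertices T V \<and>
        (without_inversions G V \<phi> \<longrightarrow> p0 \<in> V \<and> q0 \<in> V) \<and>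
        geodesic_segment T p0 q0 e \<and>
        generate G {c \<otimes> b, a \<otimes> b} \<subseteq> stabilizer G \<phi> q0 \<and>
        generate G {(c \<otimes> b) [^] n \<otimes> c, (a \<otimes> b) [^] m \<otimes> a} \<subseteq> stabilizer G \<phi> p0 \<and>
        generate G {(a \<otimes> b) \<otimes> inv (c \<otimes> b),
                    inv ((c \<otimes> b) [^] n) \<otimes> (a \<otimes> b) [^] m,
                    (c \<otimes> b) [^] n \<otimes> inv ((a \<otimes> b) [^] m),
                    (c \<otimes> b) [^] (2 * n + 1),
                    (a \<otimes> b) [^] (2 * m + 1)}
          \<subseteq> path_stabilizer G \<phi> p0 q0"
    if hyp: "\<not> elliptic a" and x: "elliptic (a \<otimes> b)" and y: "elliptic (c \<otimes> b)"
  proof -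
    obtain p q where pq: "dihedral_bridge a b m p q" using dihedral_bridge_exists[OF ab hyp x] by blast
    obtain r s where rs: "dihedral_bridge c b n r s"
      using dihedral_bridge_exists[OF cb _ y] hyp ell by blast
    have "dihedral_bridge c b n p q"
      using rs dihedral_bridges_agree(1,2)[OF ab cb rels(1) hyp pq rs] by simp
    note stab = bridge_stabilizers[OF ab cb rels(1) hyp pq this]
    note vertices = dihedral_bridge_vertices[OF ab pq assms(7)]
    have "p \<in> T" "q \<in> T" using pq axis_in by (auto simp: dihedral_bridge_def)
    then obtain e where e: "geodesic_segment T p q e"
      using simplicial_tree_real_tree[OF assms(7)] unfolding real_tree_def by meson
    have "q \<in> subdivision_vertices T V" using vertices(1) by (simp add: subdivision_vertices_def)
    then show ?thesis using vertices e stab by blast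
  qed
  ultimately show ?thesis unfolding Fix_empty_iff by blast
qed

end
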